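(* Let $X$ be a set with a map $f\colon X\to X$, and let $C=\{p_0,q_0\}\subset X$ be a subset consisting of two distinct elements with $f(p_0)\neq f(q_0)$, such that $P:=\bigcup_{n\ge1}f^n(C)$ is infinite. Then all subgroups of $W$ which are strongly of type $(X,f,C)$ are conjugate under $W$.
   Context: Tree: $T$ is the regular rooted binary tree whose vertices are the finite words over $\{0,1\}$ (root = empty word; the children of $t$ are $t0,t1$). $W=\mathrm{Aut}(T)$ is the profinite group of automorphisms of $T$ fixing the root; $T_n$ is the truncation of $T$ at level $n$. Identifying the subtrees below the vertices $0$ and $1$ with $T$ gives $W=(W\times W)\rtimes\langle\sigma\rangle$, where $(u,v)$ acts by $u$ on the first and by $v$ on the second subtree, and $\sigma$ is the involution interchanging the two subtrees, so $\sigma(u,v)=(v,u)\sigma$. The symbol $\sim$ denotes conjugacy under $W$. Types: suppose that for every $p\in P$ an element $b_p\in W$ is given, and let $G$ be the closure of the subgroup of $W$ generated by all $b_p$, $p\in P$. The elements $b_p$ and the group $G$ are called weakly of type $(X,f,C)$ if for every $p\in P$: - $b_p\sim\sigma$ if $p=f(c)$ for some $c\in C\setminus P$; - $b_p\sim(b_c,1)\,\sigma$ if $p=f(c)$ for some $c\in C\cap P$; - $b_p\sim(b_q,1)$ if $p=f(q)$ for a unique $q\in P\setminus C$; - $b_p\sim(b_q,b_{q'})$ if $p=f(q)=f(q')$ for distinct $q,q'\in P\setminus C$. They are called strongly of type $(X,f,C)$ if, in addition, the infinite product of all $b_p$ in some order converges to the identity element of $W$; that is, for some total ordering of $P$, for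 every $n$ the product in that order of the (finitely many) nontrivial restrictions $b_p|_{T_n}$ is equal to $1$. *)

theory Defs
  imports "HOL-Analysis.Abstract_Topology" "HOL-Algebra.Generated_Groups"
begin

text \<open>
  Vertices of the binary tree are words over the alphabet \<open>bool\<close>, with \<open>False\<close> for \<open>0\<close> and
  \<open>True\<close> for \<open>1\<close>. The first letter of a word is the head of the list, so the children of \<open>t\<close>
  are \<open>t @ [x]\<close>, and the subtrees below the vertices \<open>0\<close> and \<open>1\<close> consist of the words
  \<open>False # t\<close> and \<open>True # t\<close>.
\<close>

type_synonym vertex = "bool list"

definition tree_edge :: "vertex \<Rightarrow> vertex \<Rightarrow> bool" where
  "tree_edge s t \<longleftrightarrow> (\<exists>x. t = s @ [x]) \<or> (\<exists>x. s = t @ [x])"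

definition tree_level :: "nat \<Rightarrow> vertex set" where
  "tree_level n = {t. length t \<le> n}"

definition treeW :: "(vertex \<Rightarrow> vertex) monoid" where
  "treeW = \<lparr>carrier = {g. bij g \<and> g [] = [] \<and> (\<forall>s t. tree_edge (g s) (g t) \<longleftrightarrow> tree_edge s t)},
            monoid.mult = (\<circ>), one = id\<rparr>"

text \<open>
  The profinite topology: the initial topology for the restriction maps to the discrete finite
  groups \<open>Aut(T\<^sub>n)\<close>.
\<close>

definition treeW_topology :: "(vertex \<Rightarrow> vertex) topology" where
  "treeW_topology = topology_generated_by
     {{g \<in> carrier treeW. restrict g (tree_level n) = restrict h (tree_level n)} |h n.
        h \<in> carrier treeW}"

fun sigma :: "vertex \<Rightarrow> vertex" where
  "sigma [] = []"
| "sigma (x # t) = (\<not> x) # t"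

fun tree_pair :: "(vertex \<Rightarrow> vertex) \<Rightarrow> (vertex \<Rightarrow> vertex) \<Rightarrow> vertex \<Rightarrow> vertex" where
  "tree_pair u v [] = []"
| "tree_pair u v (x # t) = x # (if x then v t else u t)"

definition conj_W :: "(vertex \<Rightarrow> vertex) \<Rightarrow> (vertex \<Rightarrow> vertex) \<Rightarrow> bool" (infix "\<sim>\<^sub>W" 50) where
  "g \<sim>\<^sub>W h \<longleftrightarrow> (\<exists>w \<in> carrier treeW. g = w \<otimes>\<^bsub>treeW\<^esub> h \<otimes>\<^bsub>treeW\<^esub> inv\<^bsub>treeW\<^esub> w)"

definition subgroups_conj_W :: "(vertex \<Rightarrow> vertex) set \<Rightarrow> (vertex \<Rightarrow> vertex) set \<Rightarrow> bool" where
  "subgroups_conj_W G H \<longleftrightarrow>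
     (\<exists>w \<in> carrier treeW. G = (\<lambda>h. w \<otimes>\<^bsub>treeW\<^esub> h \<otimes>\<^bsub>treeW\<^esub> inv\<^bsub>treeW\<^esub> w) ` H)"

definition postcritical :: "('x \<Rightarrow> 'x) \<Rightarrow> 'x set \<Rightarrow> 'x set" where
  "postcritical f C = (\<Union>n\<in>{1..}. (f ^^ n) ` C)"

text \<open>
  Only the values \<open>b p\<close> for \<open>p\<close> in the postcritical set matter. The type conditions are imposed
  independently of each other, so if several of them apply to the same \<open>p\<close>, all must hold.
\<close>

definition weakly_of_type ::
  "('x \<Rightarrow> 'x) \<Rightarrow> 'x set \<Rightarrow> ('x \<Rightarrow> vertex \<Rightarrow> vertex) \<Rightarrow> bool" where
  "weakly_of_type f C b \<longleftrightarrow>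
     (let P = postcritical f C in
       (\<forall>p\<in>P. b p \<in> carrier treeW) \<and>
       (\<forall>p\<in>P.
         (\<forall>c \<in> C - P. p = f c \<longrightarrow> b p \<sim>\<^sub>W sigma) \<and>
         (\<forall>c \<in> C \<inter> P. p = f c \<longrightarrow> b p \<sim>\<^sub>W tree_pair (b c) \<one>\<^bsub>treeW\<^esub> \<otimes>\<^bsub>treeW\<^esub> sigma) \<and>
         (\<forall>q \<in> P - C. p = f q \<and> (\<forall>r \<in> P - C. p = f r \<longrightarrow> r = q) \<longrightarrow>
            b p \<sim>\<^sub>W tree_pair (b q) \<one>\<^bsub>treeW\<^esub>) \<and>
         (\<forall>q \<in> P - C. \<forall>q' \<in> P - C. q \<noteq> q' \<and> p = f q \<and> p = f q' \<longrightarrow>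
            b p \<sim>\<^sub>W tree_pair (b q) (b q'))))"

text \<open>
  For every level \<open>n\<close>, the list \<open>ps\<close> enumerates in the given order the indices \<open>p\<close> for which
  \<open>b p\<close> acts nontrivially on \<open>T\<^sub>n\<close>; in particular there are only finitely many of them.
\<close>

definition ordered_product_one ::
  "'x set \<Rightarrow> 'x rel \<Rightarrow> ('x \<Rightarrow> vertex \<Rightarrow> vertex) \<Rightarrow> bool" where
  "ordered_product_one P ord b \<longleftrightarrow>
     (\<forall>n. \<exists>ps. distinct ps \<and> sorted_wrt (\<lambda>p q. (p, q) \<in> ord) ps \<and>
        set ps = {p \<in> P. restrict (b p) (tree_level n) \<noteq> restrict id (tree_level n)} \<and>
        restrict (foldr (\<lambda>p g. b p \<otimes>\<^bsub>treeW\<^esub> g) ps \<one>\<^bsub>treeW\<^esub>) (tree_level n)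
          = restrict id (tree_level n))"

definition strongly_of_type ::
  "('x \<Rightarrow> 'x) \<Rightarrow> 'x set \<Rightarrow> ('x \<Rightarrow> vertex \<Rightarrow> vertex) \<Rightarrow> bool" where
  "strongly_of_type f C b \<longleftrightarrow>
     weakly_of_type f C b \<and>
     (\<exists>ord. linear_order_on (postcritical f C) ord \<and> ordered_product_one (postcritical f C) ord b)"

definition group_strongly_of_type ::
  "('x \<Rightarrow> 'x) \<Rightarrow> 'x set \<Rightarrow> (vertex \<Rightarrow> vertex) set \<Rightarrow> bool" where
  "group_strongly_of_type f C G \<longleftrightarrow>
     (\<exists>b. strongly_of_type f C b \<and>
          G = Abstract_Topology.closure_of treeW_topology (generate treeW (b ` postcritical f C)))"

end

theory Submission
  imports Defs "HOL-Library.Multiset"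
begin

text \<open>
  Let \<open>G\<close> be generated by elements \<open>b\<^sub>p\<close> of the given type; one of the orbits of \<open>p\<^sub>0\<close> and
  \<open>q\<^sub>0\<close> is infinite. The first components of the elements of \<open>G\<close> fixing level one contain
  conjugates of the \<open>b\<^sub>p\<close>, which again form a system of the same type; this allows induction
  on the level.

  Suppose first that the two orbits do not merge, or that they merge after different numbers of steps.
  By induction the \<open>z\<close> with \<open>(z, 1) \<in> G\<close> form a normal subgroup of \<open>W\<close>. It contains all
  the components except possibly those at the merging points, and there conjugacy in \<open>W\<close> between
  points of the two orbits at the same distance from the critical values closes the gap. If one critical
  point lies on the orbit of the other, the normal subgroup has index at most two, and the square that
  appears at this point shows that the index is one. In all these cases \<open>G = W\<close>.

  Suppose now that \<open>f\<^sup>n(p\<^sub>0) = f\<^sup>n(q\<^sub>0)\<close> happens first for some \<open>n \<ge> 2\<close>. After a conjugation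
  \<open>b\<close> at \<open>f(p\<^sub>0)\<close> is \<open>\<sigma>\<close>, \<open>b\<close> at \<open>f(q\<^sub>0)\<close> is \<open>(u, u\<^sup>-\<^sup>1) \<sigma>\<close>, and the product
  relation determines \<open>u\<close> and descends to the components. If \<open>G\<^sub>1\<close> is the group generated by
  the components, then \<open>G\<close> contains the diagonal of \<open>G\<^sub>1 \<times> G\<^sub>1\<close> and a subgroup \<open>N \<times> 1\<close> with
  \<open>N\<close> of index at most two in \<open>G\<^sub>1\<close>. This suffices to lift to the next level that two systems
  are, up to a common conjugation, conjugate element by element under the group they generate.
  The conjugating elements at the various levels have a limit by compactness of \<open>W\<close>.
\<close>

section \<open>Groups written additively\<close>

text \<open>Rewriting to reduced words of a free group: differences are removed, sums nest to the
  right, inverse neighbours cancel. It is applied with \<open>simp only\<close> because the default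
  simp set would turn x + - y back into a difference.\<close>

lemmas grp_simps = diff_conv_add_uminus add.assoc minus_add minus_minus add_minus_cancel
  minus_add_cancel add_0_left add_0_right minus_zero left_minus right_minus

definition subgrp :: "'a::group_add set \<Rightarrow> bool" where
  "subgrp H \<longleftrightarrow> 0 \<in> H \<and> (\<forall>x\<in>H. \<forall>y\<in>H. x + y \<in> H) \<and> (\<forall>x\<in>H. - x \<in> H)"

lemma subgrpI:
  assumes "0 \<in> H" "\<And>x y. x \<in> H \<Longrightarrow> y \<in> H \<Longrightarrow> x + y \<in> H" "\<And>x. x \<in> H \<Longrightarrow> - x \<in> H"
  shows "subgrp H"
  using assms by (auto simp: subgrp_def)

lemma subgrp_0: "subgrp H \<Longrightarrow> 0 \<in> H"
  and subgrp_add: "subgrp H \<Longrightarrow> x \<in> H \<Longrightarrow> y \<in> H \<Longrightarrow> x + y \<in> H"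
  and subgrp_minus: "subgrp H \<Longrightarrow> x \<in> H \<Longrightarrow> - x \<in> H"
  by (auto simp: subgrp_def)

lemma subgrp_diff: "subgrp H \<Longrightarrow> x \<in> H \<Longrightarrow> y \<in> H \<Longrightarrow> x - y \<in> H"
  by (metis diff_conv_add_uminus subgrp_add subgrp_minus)

lemma subgrp_minus_iff: "subgrp H \<Longrightarrow> - x \<in> H \<longleftrightarrow> x \<in> H"
  by (metis minus_minus subgrp_minus)

lemma subgrp_add_left_iff: "subgrp H \<Longrightarrow> x \<in> H \<Longrightarrow> x + y \<in> H \<longleftrightarrow> y \<in> H"
  by (metis minus_add_cancel subgrp_add subgrp_minus)

lemma subgrp_add_right_iff: "subgrp H \<Longrightarrow> y \<in> H \<Longrightarrow> x + y \<in> H \<longleftrightarrow> x \<in> H"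
  by (metis add_diff_cancel subgrp_add subgrp_diff)

lemma subgrp_sum_list: "subgrp H \<Longrightarrow> (\<And>x. x \<in> set xs \<Longrightarrow> g x \<in> H) \<Longrightarrow> sum_list (map g xs) \<in> H"
  by (induction xs) (auto simp: subgrp_0 subgrp_add)

inductive_set gen :: "'a::group_add set \<Rightarrow> 'a set" for S where
  gen_zero: "0 \<in> gen S"
| gen_base: "x \<in> S \<Longrightarrow> x \<in> gen S"
| gen_add: "x \<in> gen S \<Longrightarrow> y \<in> gen S \<Longrightarrow> x + y \<in> gen S"
| gen_minus: "x \<in> gen S \<Longrightarrow> - x \<in> gen S"

lemma subgrp_gen: "subgrp (gen S)"
  by (auto simp: subgrp_def intro: gen.intros)

lemma gen_least: "subgrp H \<Longrightarrow> S \<subseteq> H \<Longrightarrow> gen S \<subseteq> H"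
proof
  fix x assume "subgrp H" "S \<subseteq> H" "x \<in> gen S"
  from this(3,1,2) show "x \<in> H"
    by (induction) (auto simp: subgrp_def)
qed

lemma gen_superset: "S \<subseteq> gen S"
  by (auto intro: gen.intros)

lemma gen_mono: "S \<subseteq> T \<Longrightarrow> gen S \<subseteq> gen T"
  by (rule gen_least) (auto simp: subgrp_gen intro: gen.intros)

section \<open>Conjugation and conjugacy\<close>

definition conj_by :: "'a::group_add \<Rightarrow> 'a \<Rightarrow> 'a" where
  "conj_by w x = w + x - w"

lemma conj_by_zero [simp]: "conj_by w 0 = 0"
  and conj_by_0_left [simp]: "conj_by 0 x = x"
  by (simp_all add: conj_by_def)

lemma conj_by_add: "conj_by w (x + y) = conj_by w x + conj_by w y"
  by (simp only: conj_by_def grp_simps)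

lemma conj_by_minus: "conj_by w (- x) = - conj_by w x"
  by (simp only: conj_by_def grp_simps)

lemma conj_by_diff: "conj_by w (x - y) = conj_by w x - conj_by w y"
  by (simp only: conj_by_def grp_simps)

lemma conj_by_conj_by: "conj_by v (conj_by w x) = conj_by (v + w) x"
  by (simp only: conj_by_def grp_simps)

lemma conj_by_inverse [simp]: "conj_by (- w) (conj_by w x) = x" "conj_by w (conj_by (- w) x) = x"
  by (simp_all only: conj_by_def grp_simps)

lemma conj_by_inj: "conj_by w x = conj_by w y \<longleftrightarrow> x = y"
  by (metis conj_by_inverse(1))

lemma conj_by_sum_list: "conj_by w (sum_list (map g xs)) = sum_list (map (\<lambda>x. conj_by w (g x)) xs)"
  by (induction xs) (auto simp: conj_by_add)

lemma subgrp_conj_by: "subgrp H \<Longrightarrow> x \<in> H \<Longrightarrow> y \<in> H \<Longrightarrow> conj_by x y \<in> H"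
  unfolding conj_by_def by (intro subgrp_add subgrp_diff)

lemma subgrp_conj_by_iff: "subgrp H \<Longrightarrow> x \<in> H \<Longrightarrow> conj_by x y \<in> H \<longleftrightarrow> y \<in> H"
  by (metis conj_by_inverse(1) subgrp_conj_by subgrp_minus)

lemma subgrp_conj_by_vimage: "subgrp H \<Longrightarrow> subgrp {x. conj_by w x \<in> H}"
  by (rule subgrpI) (auto simp: conj_by_add conj_by_minus subgrp_0 subgrp_add subgrp_minus)

lemma gen_conj_by: "gen (conj_by w ` S) = conj_by w ` gen S"
proof (intro equalityI subsetI)
  fix x assume "x \<in> gen (conj_by w ` S)"
  then show "x \<in> conj_by w ` gen S"
  proof induction
    case gen_zero
    then show ?case using gen.gen_zero conj_by_zero by (metis image_eqI)
  next
    case (gen_base x)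
    then show ?case by (auto intro: gen.gen_base)
  next
    case (gen_add x y)
    then show ?case by (auto simp flip: conj_by_add intro: gen.gen_add)
  next
    case (gen_minus x)
    then show ?case by (auto simp flip: conj_by_minus intro: gen.gen_minus)
  qed
next
  fix x assume "x \<in> conj_by w ` gen S"
  then obtain y where y: "y \<in> gen S" "x = conj_by w y" by auto
  have "gen S \<subseteq> {x. conj_by w x \<in> gen (conj_by w ` S)}"
    by (intro gen_least subgrp_conj_by_vimage subgrp_gen) (auto intro: gen.gen_base)
  with y show "x \<in> gen (conj_by w ` S)" by auto
qed

definition cj :: "'a::group_add \<Rightarrow> 'a \<Rightarrow> bool" where
  "cj x y \<longleftrightarrow> (\<exists>w. x = conj_by w y)"

lemma cj_refl [simp]: "cj x x"
  unfolding cj_def by (metis conj_by_0_left)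

lemma cj_sym: "cj x y \<Longrightarrow> cj y x"
  unfolding cj_def by (metis conj_by_inverse(1))

lemma cj_trans: "cj x y \<Longrightarrow> cj y z \<Longrightarrow> cj x z"
  unfolding cj_def by (metis conj_by_conj_by)

lemma cj_conj_by [simp]: "cj (conj_by w x) y \<longleftrightarrow> cj x y" "cj x (conj_by w y) \<longleftrightarrow> cj x y"
  by (metis cj_def cj_sym cj_trans)+

lemma cj_zero_iff [simp]: "cj x 0 \<longleftrightarrow> x = 0"
  by (auto simp: cj_def)

lemma cj_involution: "cj x y \<Longrightarrow> x + x = 0 \<longleftrightarrow> y + y = 0"
  by (metis cj_def conj_by_add conj_by_inj conj_by_zero)

section \<open>The group of tree automorphisms\<close>

lemma tree_edge_append: "tree_edge s (s @ [x])"
  by (auto simp: tree_edge_def)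

text \<open>Induct on the length. Let s be the parent of t. If the edge from g s to g t went
  upwards, g t would be the parent of g s, but that is already g s' for the parent s' of s;
  injectivity then gives t = s', which is absurd.\<close>

lemma carrier_treeW_length:
  assumes "g \<in> carrier treeW"
  shows "length (g t) = length t"
proof (induction "length t" arbitrary: t rule: less_induct)
  case less
  have inj: "inj g" and nil: "g [] = []" and edge: "\<And>s t. tree_edge (g s) (g t) \<longleftrightarrow> tree_edge s t"
    using assms by (auto simp: treeW_def bij_def)
  show ?case
  proof (cases t rule: rev_cases)
    case Nil
    then show ?thesis using nil by simp
  next
    case (snoc s x)
    then have ls: "length (g s) = length s" using less by simp
    have "tree_edge (g s) (g t)" using snoc edge tree_edge_append by simp
    then consider y where "g t = g s @ [y]" | y where "g s = g t @ [y]"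
      by (auto simp: tree_edge_def)
    then show ?thesis
    proof cases
      case 1
      then show ?thesis using snoc ls by simp
    next
      case 2
      then have "s \<noteq> []" using ls by auto
      then obtain s' z where s': "s = s' @ [z]" by (metis rev_exhaust)
      have "tree_edge (g s') (g s)" using s' edge tree_edge_append by simp
      moreover have "length (g s') = length s'" using less s' snoc by simp
      ultimately obtain y' where "g s = g s' @ [y']" using ls s' by (auto simp: tree_edge_def)
      then have "g s' = g t" using 2 by simp
      then have "s' = t" using inj by (simp add: inj_eq)
      then show ?thesis using s' snoc by simp
    qed
  qed
qed

text \<open>Trades the symmetric edge condition for one on children alone; inverses, pairs and
  limits are checked against this form.\<close>

lemma carrier_treeW_iff:
  "g \<in> carrier treeW \<longleftrightarrow> bij g \<and> g [] = [] \<and> (\<forall>t x. \<exists>y. g (t @ [x]) = g t @ [y])"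
proof
  assume g: "g \<in> carrier treeW"
  have "\<exists>y. g (t @ [x]) = g t @ [y]" for t x
  proof -
    have "tree_edge (g t) (g (t @ [x]))"
      using g tree_edge_append by (auto simp: treeW_def)
    with carrier_treeW_length[OF g, of t] carrier_treeW_length[OF g, of "t @ [x]"]
    show ?thesis by (auto simp: tree_edge_def)
  qed
  with g show "bij g \<and> g [] = [] \<and> (\<forall>t x. \<exists>y. g (t @ [x]) = g t @ [y])"
    by (auto simp: treeW_def)
next
  assume *: "bij g \<and> g [] = [] \<and> (\<forall>t x. \<exists>y. g (t @ [x]) = g t @ [y])"
  have child: "\<exists>y. t = s @ [y]" if "g t = g s @ [x]" for s t x
  proof -
    from that * have "t \<noteq> []" by auto
    then obtain t' y where "t = t' @ [y]" by (metis rev_exhaust)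
    then show ?thesis using that * by (metis append1_eq_conv bij_def inj_eq)
  qed
  have "tree_edge (g s) (g t) \<longleftrightarrow> tree_edge s t" for s t
    unfolding tree_edge_def using * child by metis
  with * show "g \<in> carrier treeW" by (auto simp: treeW_def)
qed

lemma id_carrier_treeW: "id \<in> carrier treeW"
  by (auto simp: carrier_treeW_iff)

lemma comp_carrier_treeW: "g \<in> carrier treeW \<Longrightarrow> h \<in> carrier treeW \<Longrightarrow> g \<circ> h \<in> carrier treeW"
  unfolding carrier_treeW_iff by (auto intro: bij_comp) metis

lemma inv_carrier_treeW:
  assumes "g \<in> carrier treeW" shows "inv_into UNIV g \<in> carrier treeW"
proof -
  have g: "bij g" "g [] = []" "\<And>t x. \<exists>y. g (t @ [x]) = g t @ [y]"
    using assms by (auto simp: carrier_treeW_iff)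
  have [simp]: "g (inv_into UNIV g t) = t" "inv_into UNIV g (g t) = t" for t
    using g(1) by (auto simp: bij_def surj_f_inv_f)
  have "\<exists>y. inv_into UNIV g (t @ [x]) = inv_into UNIV g t @ [y]" for t x
  proof -
    have "inv_into UNIV g (t @ [x]) \<noteq> []"
    proof
      assume "inv_into UNIV g (t @ [x]) = []"
      then have "g (inv_into UNIV g (t @ [x])) = []" using g(2) by simp
      then show False by simp
    qed
    then obtain s y where s: "inv_into UNIV g (t @ [x]) = s @ [y]" by (metis rev_exhaust)
    then have "g (s @ [y]) = t @ [x]" by (metis \<open>g (inv_into UNIV g (t @ [x])) = t @ [x]\<close>)
    then have "g s = t" using g(3)[of s y] by auto
    then show ?thesis using s by auto
  qed
  moreover have "inv_into UNIV g [] = []" using g(2) by (metis \<open>\<And>t. inv_into UNIV g (g t) = t\<close>)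
  ultimately show ?thesis using g(1) by (auto simp: carrier_treeW_iff bij_imp_bij_inv)
qed

lemma group_treeW: "group treeW"
proof (rule groupI)
  fix x assume "x \<in> carrier treeW"
  then show "\<exists>y\<in>carrier treeW. y \<otimes>\<^bsub>treeW\<^esub> x = \<one>\<^bsub>treeW\<^esub>"
    using inv_carrier_treeW[of x]
    by (intro bexI[of _ "inv_into UNIV x"]) (auto simp: treeW_def bij_def)
qed (use comp_carrier_treeW id_carrier_treeW in \<open>auto simp: treeW_def comp_assoc\<close>)

lemma sigma_carrier: "sigma \<in> carrier treeW"
proof -
  have [simp]: "sigma (sigma t) = t" for t by (cases t) auto
  have "bij sigma" by (rule o_bij[of sigma]) auto
  moreover have "\<exists>y. sigma (t @ [x]) = sigma t @ [y]" for t x by (cases t) auto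
  ultimately show ?thesis by (auto simp: carrier_treeW_iff)
qed

lemma tree_pair_carrier:
  assumes "u \<in> carrier treeW" "v \<in> carrier treeW"
  shows "tree_pair u v \<in> carrier treeW"
proof -
  have [simp]: "u (inv_into UNIV u t) = t" "inv_into UNIV u (u t) = t" "v (inv_into UNIV v t) = t" "inv_into UNIV v (v t) = t" for t
    using assms by (auto simp: carrier_treeW_iff bij_def surj_f_inv_f)
  have "tree_pair u v (tree_pair (inv_into UNIV u) (inv_into UNIV v) t) = t" "tree_pair (inv_into UNIV u) (inv_into UNIV v) (tree_pair u v t) = t"
    for t by (cases t; simp)+
  then have "bij (tree_pair u v)" by (intro o_bij[of "tree_pair (inv_into UNIV u) (inv_into UNIV v)"]) auto
  moreover have "\<exists>y. tree_pair u v (t @ [x]) = tree_pair u v t @ [y]" for t x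
    using assms by (cases t) (auto simp: carrier_treeW_iff)
  ultimately show ?thesis by (auto simp: carrier_treeW_iff)
qed

text \<open>
  Composition is written additively because \<^class>\<open>group_add\<close> is the type class of groups that
  are not necessarily commutative.
\<close>

typedef tree_aut = "carrier treeW" morphisms app Tree_Aut
  using id_carrier_treeW by blast

setup_lifting type_definition_tree_aut

instantiation tree_aut :: group_add
begin

lift_definition zero_tree_aut :: tree_aut is id by (rule id_carrier_treeW)
lift_definition plus_tree_aut :: "tree_aut \<Rightarrow> tree_aut \<Rightarrow> tree_aut" is "(\<circ>)"
  by (rule comp_carrier_treeW)
lift_definition uminus_tree_aut :: "tree_aut \<Rightarrow> tree_aut" is "inv_into UNIV"
  by (rule inv_carrier_treeW)
definition minus_tree_aut :: "tree_aut \<Rightarrow> tree_aut \<Rightarrow> tree_aut" where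
  "minus_tree_aut x y = x + - y"

instance
proof
  fix a b c :: tree_aut
  show "a + b + c = a + (b + c)" by transfer (simp add: comp_assoc)
  show "0 + a = a" "a + 0 = a" by (transfer; simp)+
  show "- a + a = 0" by transfer (auto simp: carrier_treeW_iff bij_def)
  show "a + - b = a - b" by (simp add: minus_tree_aut_def)
qed

end

section \<open>The decomposition of W into pairs and the flip\<close>

lift_definition flip :: tree_aut is sigma by (rule sigma_carrier)
lift_definition pair :: "tree_aut \<Rightarrow> tree_aut \<Rightarrow> tree_aut" is tree_pair by (rule tree_pair_carrier)

lemma app_add [simp]: "app (g + h) t = app g (app h t)"
  and app_zero [simp]: "app 0 t = t"
  and app_flip [simp]: "app flip t = sigma t"
  and app_pair [simp]: "app (pair u v) t = tree_pair (app u) (app v) t"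
  by (simp_all add: plus_tree_aut.rep_eq zero_tree_aut.rep_eq flip.rep_eq pair.rep_eq)

lemma tree_aut_eqI: "(\<And>t. app g t = app h t) \<Longrightarrow> g = h"
  by (metis app_inject ext)

lemma app_Nil [simp]: "app g [] = []"
  using app[of g] by (auto simp: carrier_treeW_iff)

lemma app_eq_iff [simp]: "app g s = app g t \<longleftrightarrow> s = t"
  using app[of g] by (auto simp: carrier_treeW_iff bij_def inj_eq)

lemma length_app [simp]: "length (app g t) = length t"
  using app[of g] carrier_treeW_length by blast

lemma pair_add: "pair u v + pair u' v' = pair (u + u') (v + v')"
  by (rule tree_aut_eqI, case_tac t) auto

lemma pair_zero: "pair 0 0 = 0"
  by (rule tree_aut_eqI, case_tac t) auto

lemma pair_minus: "- pair u v = pair (- u) (- v)"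
  by (rule minus_unique) (simp add: pair_add pair_zero)

lemma pair_diff: "pair u v - pair u' v' = pair (u - u') (v - v')"
  by (simp only: diff_conv_add_uminus pair_add pair_minus)

lemma flip_add_pair: "flip + pair u v = pair v u + flip"
  by (rule tree_aut_eqI, case_tac t) auto

lemma flip_add_flip: "flip + flip = 0"
  by (rule tree_aut_eqI, case_tac t) auto

lemma flip_minus: "- flip = flip"
  by (rule minus_unique) (simp add: flip_add_flip)

lemma pair_add_left: "pair u v + (pair u' v' + x) = pair (u + u') (v + v') + x"
  and flip_add_pair_left: "flip + (pair u v + x) = pair v u + (flip + x)"
  and flip_add_flip_left: "flip + (flip + x) = x"
  by (simp_all only: pair_add flip_add_pair flip_add_flip add_0_left flip: add.assoc)

text \<open>Moves every flip to the right past the pairs, so that each word reduces to (u, v) or (u,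
  v) flip. The \<open>_left\<close> variants act inside sums nested to the right.\<close>

lemmas pair_simps = pair_add pair_zero pair_minus flip_add_pair flip_add_flip flip_minus
  pair_add_left flip_add_pair_left flip_add_flip_left

lemma pair_inject [simp]: "pair u v = pair u' v' \<longleftrightarrow> u = u' \<and> v = v'"
proof
  assume *: "pair u v = pair u' v'"
  have "app u t = app u' t \<and> app v t = app v' t" for t
    using arg_cong[OF *, of "\<lambda>g. app g (False # t)"] arg_cong[OF *, of "\<lambda>g. app g (True # t)"]
    by simp
  then show "u = u' \<and> v = v'" by (auto intro: tree_aut_eqI)
qed auto

lemma pair_neq_pair_flip [simp]: "pair u v \<noteq> pair u' v' + flip" "pair u' v' + flip \<noteq> pair u v"
proof -
  have "app (pair u v) [True] \<noteq> app (pair u' v' + flip) [True]" by simp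
  then show "pair u v \<noteq> pair u' v' + flip" by metis
  then show "pair u' v' + flip \<noteq> pair u v" by metis
qed

text \<open>By injectivity the other letter is fixed as well, so every word keeps its first letter;
  the action on the remaining letters gives the two coordinates.\<close>

lemma pair_of_fixed_letters:
  assumes "app g [False] = [False]"
  shows "\<exists>u v. g = pair u v"
proof -
  have snoc: "\<exists>y. app g (t @ [x]) = app g t @ [y]" for t x
    using app[of g] by (auto simp: carrier_treeW_iff)
  have "app g [True] \<noteq> [False]" by (metis app_eq_iff assms list.inject)
  moreover obtain y where "app g [True] = [y]" using snoc[of "[]" True] by auto
  ultimately have g1: "app g [x] = [x]" for x using assms by (cases x) auto
  have "\<exists>t'. app g (x # t) = x # t'" for x t
  proof (induction t rule: rev_induct)
    case Nil
    then show ?case using g1 by simp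
  next
    case (snoc y t)
    then show ?case using \<open>\<And>t x. \<exists>y. app g (t @ [x]) = app g t @ [y]\<close>[of "x # t" y] by auto
  qed
  then obtain h where h: "\<And>x t. app g (x # t) = x # h x t" by metis
  have "h x \<in> carrier treeW" for x
    unfolding carrier_treeW_iff
  proof (intro conjI allI)
    show "h x [] = []" using h[of x "[]"] g1 by simp
    have "inj (h x)"
    proof (rule injI)
      fix s t assume "h x s = h x t"
      then have "app g (x # s) = app g (x # t)" using h by simp
      then show "s = t" by simp
    qed
    moreover have "surj (h x)"
    proof -
      have "\<exists>s. t = h x s" for t
      proof -
        obtain s where s: "app g s = x # t"
          using app[of g] by (auto simp: carrier_treeW_iff bij_def) (metis surjD)
        then obtain y s' where "s = y # s'" by (cases s) auto
        then show ?thesis using s h[of y s'] by auto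
      qed
      then show ?thesis by (auto simp: surj_def)
    qed
    ultimately show "bij (h x)" by (simp add: bij_def)
  next
    fix t y
    show "\<exists>z. h x (t @ [y]) = h x t @ [z]" using snoc[of "x # t" y] h by auto
  qed
  then have h': "app (Tree_Aut (h x)) = h x" for x by (simp add: Tree_Aut_inverse)
  have "g = pair (Tree_Aut (h False)) (Tree_Aut (h True))"
    by (rule tree_aut_eqI, case_tac t) (auto simp: h h')
  then show ?thesis by blast
qed

lemma tree_aut_cases:
  obtains u v where "g = pair u v" | u v where "g = pair u v + flip"
proof -
  have "app g [False] = [False] \<or> app (g + flip) [False] = [False]"
  proof (rule ccontr)
    assume "\<not> ?thesis"
    moreover obtain y where "app g [False] = [y]" 
      using length_app[of g "[False]"] by (auto simp: length_Suc_conv simp del: length_app)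
    moreover obtain z where "app g [True] = [z]" 
      using length_app[of g "[True]"] by (auto simp: length_Suc_conv simp del: length_app)
    ultimately have "app g [False] = app g [True]" by simp
    then show False by (simp only: app_eq_iff) simp
  qed
  then show ?thesis
  proof
    assume "app g [False] = [False]"
    then show ?thesis using pair_of_fixed_letters that(1) by blast
  next
    assume "app (g + flip) [False] = [False]"
    then obtain u v where "g + flip = pair u v" using pair_of_fixed_letters by blast
    then have "g = pair u v + flip" by (metis add.assoc flip_add_flip add_0_right)
    then show ?thesis by (rule that(2))
  qed
qed

lemma conj_by_pair: "conj_by (pair x y) (pair u v) = pair (conj_by x u) (conj_by y v)"
  by (simp only: conj_by_def grp_simps pair_simps)

lemma conj_by_pair_flip: "conj_by (pair x y) (pair u v + flip) = pair (x + u - y) (y + v - x) + flip"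
  by (simp only: conj_by_def grp_simps pair_simps)

lemma conj_by_flip: "conj_by flip (pair u v) = pair v u"
  by (simp only: conj_by_def grp_simps pair_simps)

lemma conj_by_pair_of_flip: "conj_by (pair x x) flip = flip"
  by (simp only: conj_by_def grp_simps pair_simps)

text \<open>Conjugation by (x, y) acts in each coordinate, and a further flip swaps the coordinates;
  hence the alternative in the conclusion.\<close>

lemma cj_pairE:
  assumes "cj g (pair u v)"
  obtains u' v' where "cj u' u" "cj v' v" "g = pair u' v' \<or> g = pair v' u'"
proof -
  obtain w where w: "g = conj_by w (pair u v)" using assms by (auto simp: cj_def)
  show ?thesis
  proof (cases w rule: tree_aut_cases)
    case (1 x y)
    then show ?thesis using w that[of "conj_by x u" "conj_by y v"] by (simp add: conj_by_pair)
  next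
    case (2 x y)
    then have "g = pair (conj_by x v) (conj_by y u)"
      using w by (simp add: conj_by_pair conj_by_flip flip: conj_by_conj_by)
    then show ?thesis using that[of "conj_by y u" "conj_by x v"] by simp
  qed
qed

lemma cj_pairI: "cj u u' \<Longrightarrow> cj v v' \<Longrightarrow> cj (pair u v) (pair u' v')"
  unfolding cj_def by (metis conj_by_pair)

lemma cj_pair_flipI: "cj u u' \<Longrightarrow> cj (pair u 0 + flip) (pair u' 0 + flip)"
proof -
  assume "cj u u'"
  then obtain w where "u = conj_by w u'" by (auto simp: cj_def)
  then have "pair u 0 + flip = conj_by (pair w w) (pair u' 0 + flip)"
    by (simp add: conj_by_pair_flip) (simp add: conj_by_def)
  then show ?thesis by (auto simp: cj_def)
qed

lemma cj_flipE:
  assumes "cj g flip"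
  obtains u where "g = pair u (- u) + flip"
proof -
  obtain w where w: "g = conj_by w flip" using assms by (auto simp: cj_def)
  show ?thesis
  proof (cases w rule: tree_aut_cases)
    case (1 x y)
    have "g = pair (x + - y) (- (x + - y)) + flip"
      unfolding w 1 by (simp only: conj_by_def grp_simps pair_simps)
    then show ?thesis by (rule that)
  next
    case (2 x y)
    have "g = pair (x + - y) (- (x + - y)) + flip"
      unfolding w 2 by (simp only: conj_by_def grp_simps pair_simps)
    then show ?thesis by (rule that)
  qed
qed

text \<open>Conjugation by (x, y) produces z = x - y, which is arbitrary. Only the class of the
  product of the two coordinates survives, and it is the class of a.\<close>

lemma cj_pair_flipE:
  assumes "cj g (pair a 0 + flip)"
  obtains a' z where "cj a' a" "g = pair (a' + z) (- z) + flip"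
proof -
  obtain w where w: "g = conj_by w (pair a 0 + flip)" using assms by (auto simp: cj_def)
  show ?thesis
  proof (cases w rule: tree_aut_cases)
    case (1 x y)
    have "g = pair (conj_by x a + (x + - y)) (- (x + - y)) + flip"
      unfolding w 1 by (simp only: conj_by_def grp_simps pair_simps)
    then show ?thesis using that[of "conj_by x a"] by simp
  next
    case (2 x y)
    have "g = pair (conj_by x a + (x + - a + - y)) (- (x + - a + - y)) + flip"
      unfolding w 2 by (simp only: conj_by_def grp_simps pair_simps)
    then show ?thesis using that[of "conj_by x a"] by simp
  qed
qed

text \<open>Conjugates of a pair are pairs. This makes two type conditions incompatible in
  \<open>not_typed\<close>.\<close>

lemma cj_pair_flip_not_cj_pair: "cj g (pair a b + flip) \<Longrightarrow> \<not> cj g (pair u v)"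
proof
  assume "cj g (pair a b + flip)" "cj g (pair u v)"
  then have "cj (pair a b + flip) (pair u v)" by (meson cj_sym cj_trans)
  then show False by (elim cj_pairE) (metis pair_neq_pair_flip(2))
qed

section \<open>Level kernels\<close>

text \<open>The kernel of restriction to level n (see \<open>lev_iff\<close>), defined along pairs
  so that an induction passes from an element to its components. Statements about the finite
  quotients are made by adjoining \<open>lev n\<close> to a generating set.\<close>

primrec lev :: "nat \<Rightarrow> tree_aut set" where
  "lev 0 = UNIV"
| "lev (Suc n) = {pair u v |u v. u \<in> lev n \<and> v \<in> lev n}"

declare lev.simps(2) [simp del]

lemma pair_in_lev_Suc [simp]: "pair u v \<in> lev (Suc n) \<longleftrightarrow> u \<in> lev n \<and> v \<in> lev n"
  by (auto simp: lev.simps(2))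

lemma lev_iff: "g \<in> lev n \<longleftrightarrow> (\<forall>t. length t \<le> n \<longrightarrow> app g t = t)"
proof (induction n arbitrary: g)
  case 0
  then show ?case by simp
next
  case (Suc n)
  show ?case
  proof (cases g rule: tree_aut_cases)
    case (1 u v)
    have "(\<forall>t. length t \<le> Suc n \<longrightarrow> app g t = t) \<longleftrightarrow>
        (\<forall>t. length t \<le> n \<longrightarrow> app u t = t) \<and> (\<forall>t. length t \<le> n \<longrightarrow> app v t = t)" (is "?L \<longleftrightarrow> ?R")
    proof
      assume L: ?L
      show ?R
      proof (intro conjI allI impI)
        fix t :: vertex assume "length t \<le> n"
        then show "app u t = t" "app v t = t"
          using L[rule_format, of "False # t"] L[rule_format, of "True # t"] 1 by simp_all
      qed
    next
      assume R: ?R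
      show ?L
      proof (intro allI impI)
        fix t :: vertex assume "length t \<le> Suc n"
        then show "app g t = t" using R 1 by (cases t) auto
      qed
    qed
    then show ?thesis using 1 Suc by simp
  next
    case (2 u v)
    have "app g [True] \<noteq> [True]" using 2 by simp
    moreover have "g \<notin> lev (Suc n)" using 2 by (auto simp: lev.simps(2))
    moreover have "length [True] \<le> Suc n" by simp
    ultimately show ?thesis by blast
  qed
qed

lemma subgrp_lev: "subgrp (lev n)"
proof (induction n)
  case (Suc n)
  show ?case
  proof (rule subgrpI)
    show "0 \<in> lev (Suc n)" using Suc pair_in_lev_Suc[of 0 0 n] by (simp add: subgrp_0 pair_zero)
  next
    fix x y assume "x \<in> lev (Suc n)" "y \<in> lev (Suc n)"
    then show "x + y \<in> lev (Suc n)" using Suc by (auto simp: lev.simps(2) pair_add subgrp_add)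
  next
    fix x assume "x \<in> lev (Suc n)"
    then show "- x \<in> lev (Suc n)" using Suc by (auto simp: lev.simps(2) pair_minus subgrp_minus)
  qed
qed (auto simp: subgrp_def)

lemma lev_conj_by [simp]: "conj_by w x \<in> lev n \<longleftrightarrow> x \<in> lev n"
proof -
  have imp: "conj_by w x \<in> lev n" if "x \<in> lev n" for w x
    unfolding lev_iff
  proof (intro allI impI)
    fix t :: vertex assume "length t \<le> n"
    then have "app x (app (- w) t) = app (- w) t" using that by (auto simp: lev_iff)
    then have "app (conj_by w x) t = app (w + - w) t" by (simp add: conj_by_def del: add.right_inverse
      add_uminus_conv_diff add: diff_conv_add_uminus)
    then show "app (conj_by w x) t = t" by simp
  qed
  show ?thesis using imp[of x w] imp[of "conj_by w x" "- w"] by auto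
qed

text \<open>The two products are conjugate and the kernel is normal. This permits cyclic rotation of
  a product relation.\<close>

lemma lev_add_commute: "x + y \<in> lev n \<longleftrightarrow> y + x \<in> lev n"
proof -
  have "y + x = conj_by (- x) (x + y)" by (simp only: conj_by_def grp_simps)
  then show ?thesis by (metis lev_conj_by)
qed

lemma conj_by_image_lev: "conj_by w ` lev n = lev n"
proof (intro equalityI subsetI)
  fix x assume "x \<in> lev n"
  then have "conj_by (- w) x \<in> lev n" by simp
  then show "x \<in> conj_by w ` lev n" by (metis conj_by_inverse(2) image_eqI)
qed auto

lemma lev_Suc_subset: "lev (Suc n) \<subseteq> lev n"
  by (auto simp: lev_iff)

text \<open>Representatives at level n + 1 are pairs of representatives at level n, with or without
  a flip. Finiteness feeds the pigeonhole step in \<open>compactness\<close>.\<close>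

lemma lev_finite_index: "\<exists>F. finite F \<and> (\<forall>g. \<exists>h\<in>F. - h + g \<in> lev n)"
proof (induction n)
  case 0
  show ?case by (rule exI[of _ "{0}"]) simp
next
  case (Suc n)
  then obtain F where F: "finite F" "\<And>g. \<exists>h\<in>F. - h + g \<in> lev n" by blast
  let ?F = "case_prod pair ` (F \<times> F)"
  let ?F' = "?F \<union> (\<lambda>x. x + flip) ` ?F"
  have "\<exists>h\<in>?F'. - h + g \<in> lev (Suc n)" for g
  proof (cases g rule: tree_aut_cases)
    case (1 u v)
    obtain u' v' where "u' \<in> F" "- u' + u \<in> lev n" "v' \<in> F" "- v' + v \<in> lev n"
      using F(2) by meson
    then show ?thesis unfolding 1 by (intro bexI[of _ "pair u' v'"]) (auto simp: pair_minus pair_add)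
  next
    case (2 u v)
    obtain u' v' where uv: "u' \<in> F" "- u' + u \<in> lev n" "v' \<in> F" "- v' + v \<in> lev n"
      using F(2) by meson
    have "- (pair u' v' + flip) + g = pair (- v' + v) (- u' + u)"
      unfolding 2 by (simp only: grp_simps pair_simps)
    then have "- (pair u' v' + flip) + g \<in> lev (Suc n)" using uv by simp
    then show ?thesis using uv by (intro bexI[of _ "pair u' v' + flip"]) auto
  qed
  moreover have "finite ?F'" using F(1) by simp
  ultimately show ?case by blast
qed

section \<open>Systems generating the whole group\<close>

text \<open>The set is the union of N and the coset N d^-1; it is closed because d normalises N and
  d d lies in N.\<close>

lemma subgrp_index_two:
  assumes N: "subgrp N" and d: "\<And>y. conj_by d y \<in> N \<longleftrightarrow> y \<in> N" and dd: "d + d \<in> N"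
  shows "subgrp {x. x \<in> N \<or> x + d \<in> N}" (is "subgrp ?Q")
proof -
  have d': "conj_by (- d) y \<in> N \<longleftrightarrow> y \<in> N" for y
    using d[of "conj_by (- d) y"] by simp
  show ?thesis
  proof (rule subgrpI)
    show "0 \<in> ?Q" using N by (simp add: subgrp_0)
  next
    fix x y assume *: "x \<in> ?Q" "y \<in> ?Q"
    show "x + y \<in> ?Q"
    proof (cases "x \<in> N")
      case True
      then show ?thesis using * N by (auto simp: add.assoc subgrp_add)
    next
      case False
      then have x: "x + d \<in> N" using * by auto
      show ?thesis
      proof (cases "y \<in> N")
        case True
        then have "(x + d) + conj_by (- d) y \<in> N" by (intro subgrp_add[OF N x]) (simp only: d')
        moreover have "(x + d) + conj_by (- d) y = x + y + d"
          by (simp only: conj_by_def grp_simps)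
        ultimately show ?thesis by simp
      next
        case False
        then have "y + d \<in> N" using * by auto
        then have "(x + d) + conj_by (- d) (y + d) \<in> N" by (intro subgrp_add[OF N x]) (simp only: d')
        moreover have "(x + d) + conj_by (- d) (y + d) = (x + y) + (d + d)"
          by (simp only: conj_by_def grp_simps)
        ultimately show ?thesis using dd N by (simp add: subgrp_add_right_iff)
      qed
    qed
  next
    fix x assume *: "x \<in> ?Q"
    have "- x + d \<in> N" if "x + d \<in> N"
    proof -
      have "conj_by d (- (x + d)) + (d + d) \<in> N" 
        using that by (intro subgrp_add[OF N _ dd]) (simp only: d subgrp_minus_iff[OF N])
      moreover have "conj_by d (- (x + d)) + (d + d) = - x + d" by (simp only: conj_by_def grp_simps)
      ultimately show ?thesis by simp
    qed
    then show "- x \<in> ?Q" using * N by (auto simp: subgrp_minus)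
  qed
qed

section \<open>The intersection with the first factor\<close>

definition left_part :: "tree_aut set \<Rightarrow> tree_aut set" where
  "left_part H = {z. pair z 0 \<in> H}"

lemma left_part_iff: "z \<in> left_part H \<longleftrightarrow> pair z 0 \<in> H"
  by (simp add: left_part_def)

lemma subgrp_left_part:
  assumes "subgrp H" shows "subgrp (left_part H)"
proof (rule subgrpI)
  show "0 \<in> left_part H" using assms by (simp add: left_part_iff pair_zero subgrp_0)
next
  fix x y assume "x \<in> left_part H" "y \<in> left_part H"
  then show "x + y \<in> left_part H"
    using subgrp_add[OF assms, of "pair x 0" "pair y 0"] by (simp add: left_part_iff pair_add)
next
  fix x assume "x \<in> left_part H"
  then show "- x \<in> left_part H"
    using subgrp_minus[OF assms, of "pair x 0"] by (simp add: left_part_iff pair_minus)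
qed

lemma lev_subset_left_part: "lev (Suc n) \<subseteq> H \<Longrightarrow> lev n \<subseteq> left_part H"
proof
  fix x assume "lev (Suc n) \<subseteq> H" "x \<in> lev n"
  then have "pair x 0 \<in> lev (Suc n)" by (simp add: subgrp_0 subgrp_lev)
  then show "x \<in> left_part H" using \<open>lev (Suc n) \<subseteq> H\<close> by (auto simp: left_part_iff)
qed

lemma pair_swap_mem: "subgrp H \<Longrightarrow> flip \<in> H \<Longrightarrow> pair u v \<in> H \<Longrightarrow> pair v u \<in> H"
  by (metis conj_by_flip subgrp_conj_by)

lemma right_part_mem: "subgrp H \<Longrightarrow> flip \<in> H \<Longrightarrow> z \<in> left_part H \<Longrightarrow> pair 0 z \<in> H"
  by (auto simp: left_part_iff intro: pair_swap_mem)

text \<open>Dividing (x, y) by (x, 1) leaves (1, y), and the flip moves y to the left.\<close>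

lemma left_part_pairD:
  assumes "subgrp H" "flip \<in> H" "pair x y \<in> H"
  shows "x \<in> left_part H \<longleftrightarrow> y \<in> left_part H"
proof -
  have *: "b \<in> left_part H" if "pair a b \<in> H" "a \<in> left_part H" for a b
  proof -
    have "- pair a 0 + pair a b \<in> H"
      using that assms by (intro subgrp_add subgrp_minus) (auto simp: left_part_iff)
    then have "pair 0 b \<in> H" by (simp add: pair_simps)
    then show ?thesis using assms pair_swap_mem left_part_iff by blast
  qed
  show ?thesis using * assms pair_swap_mem by blast
qed

lemma left_part_UNIV:
  assumes "subgrp H" "flip \<in> H" "left_part H = UNIV"
  shows "H = UNIV"
proof -
  have "pair u v \<in> H" for u v
  proof -
    have "pair u 0 + pair 0 v \<in> H"
      using assms right_part_mem[OF assms(1,2), of v] left_part_iff[of u H]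
      by (intro subgrp_add) auto
    then show ?thesis by (simp add: pair_add)
  qed
  then have "g \<in> H" for g
    using assms by (cases g rule: tree_aut_cases) (auto intro: subgrp_add)
  then show ?thesis by auto
qed

lemma left_part_conj_by:
  assumes "subgrp H" "pair x y \<in> H"
  shows "conj_by x z \<in> left_part H \<longleftrightarrow> z \<in> left_part H"
  unfolding left_part_iff using subgrp_conj_by_iff[OF assms, of "pair z 0"]
  by (simp add: conj_by_pair)

text \<open>The conjugation takes place in W, not in H, so only some conjugate of a is found; it may
  sit on the right, which the flip in H repairs.\<close>

lemma left_part_cj_pair_zero:
  assumes "subgrp H" "flip \<in> H" "g \<in> H" "cj g (pair a 0)"
  shows "\<exists>a'. cj a' a \<and> a' \<in> left_part H"
  using assms(4) 
proof (rule cj_pairE)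
  fix a' z assume *: "cj a' a" "cj z 0" "g = pair a' z \<or> g = pair z a'"
  then have "pair a' 0 \<in> H" using assms(3) pair_swap_mem[OF assms(1,2)] by auto
  then show ?thesis using * by (auto simp: left_part_iff)
qed

text \<open>Once every element of W is a first coordinate of a pair in H, \<open>left_part H\<close>
  is normal in W.\<close>

lemma cj_left_part:
  assumes "subgrp H" "\<And>x. \<exists>y. pair x y \<in> H" "cj z z'" "z' \<in> left_part H"
  shows "z \<in> left_part H"
  using assms(2-4) left_part_conj_by[OF assms(1)] unfolding cj_def by metis

lemma subgrp_fst:
  assumes "subgrp H" shows "subgrp {x. \<exists>y. pair x y \<in> H}"
proof (rule subgrpI)
  show "0 \<in> {x. \<exists>y. pair x y \<in> H}" using assms by (auto intro!: exI[of _ 0] simp: pair_zero subgrp_0)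
next
  fix x y assume "x \<in> {x. \<exists>y. pair x y \<in> H}" "y \<in> {x. \<exists>y. pair x y \<in> H}"
  then obtain x' y' where "pair x x' \<in> H" "pair y y' \<in> H" by auto
  then show "x + y \<in> {x. \<exists>y. pair x y \<in> H}"
    using subgrp_add[OF assms, of "pair x x'" "pair y y'"] by (auto simp: pair_add)
next
  fix x assume "x \<in> {x. \<exists>y. pair x y \<in> H}"
  then obtain x' where "pair x x' \<in> H" by auto
  then show "- x \<in> {x. \<exists>y. pair x y \<in> H}"
    using subgrp_minus[OF assms, of "pair x x'"] by (auto simp: pair_minus)
qed

lemma gen_conj_by_lev: "gen (conj_by w ` S \<union> lev n) = conj_by w ` gen (S \<union> lev n)"
  by (simp add: image_Un conj_by_image_lev flip: gen_conj_by)

lemma gen_conj_by_lev_UNIV: "gen (conj_by w ` S \<union> lev n) = UNIV \<longleftrightarrow> gen (S \<union> lev n) = UNIV"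
proof -
  have "surj (conj_by w)" by (metis conj_by_inverse(2) surjI)
  then have "conj_by w ` X = UNIV \<longleftrightarrow> X = UNIV" for X
    by (metis conj_by_inj inj_image_eq_iff injI)
  then show ?thesis by (simp add: gen_conj_by_lev)
qed

text \<open>Induct on the level. After a conjugation the flip lies in the group, and the components
  form a sequence of the same kind inside \<open>left_part H\<close>; by induction they generate
  everything modulo \<open>lev n\<close>.\<close>

lemma gen_free_orbit:
  assumes "cj (a 0) flip" "\<And>i. cj (a (Suc i)) (pair (a i) 0)"
  shows "gen (range a \<union> lev n) = UNIV"
  using assms
proof (induction n arbitrary: a)
  case 0
  show ?case using gen_superset by fastforce
next
  case (Suc n)
  obtain w where w: "flip = conj_by w (a 0)" using Suc(2) cj_sym cj_def by blast
  define b where "b i = conj_by w (a i)" for i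
  define H where "H = gen (range b \<union> lev (Suc n))"
  have H: "subgrp H" "lev (Suc n) \<subseteq> H" "\<And>i. b i \<in> H"
    unfolding H_def using gen_superset by (auto intro: subgrp_gen gen_base)
  have flip: "flip \<in> H" using H(3)[of 0] w by (simp add: b_def)
  \<comment> \<open>The component of \<open>b (Suc i)\<close> becomes the i-th term of the new
    sequence.\<close>
  have "\<exists>c. cj c (b i) \<and> c \<in> left_part H" for i
    using left_part_cj_pair_zero[OF H(1) flip, of "b (Suc i)" "a i"] H(3) Suc(3)[of i] by (simp add: b_def)
  then obtain c where c: "\<And>i. cj (c i) (b i)" "\<And>i. c i \<in> left_part H" by metis
  then have ca: "cj (c i) (a i)" for i by (simp add: b_def)
  have "cj (c 0) flip" using Suc(2) ca cj_trans by blast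
  moreover have "cj (c (Suc i)) (pair (c i) 0)" for i
    using Suc(3) ca by (meson cj_pairI cj_refl cj_sym cj_trans)
  ultimately have "gen (range c \<union> lev n) = UNIV" by (rule Suc.IH)
  moreover have "gen (range c \<union> lev n) \<subseteq> left_part H"
    using c(2) lev_subset_left_part[OF H(2)] by (intro gen_least subgrp_left_part H) auto
  ultimately have "H = UNIV" using left_part_UNIV[OF H(1) flip] by auto
  then have "gen (conj_by w ` range a \<union> lev (Suc n)) = UNIV"
    by (simp add: H_def b_def image_image)
  then show ?case by (simp only: gen_conj_by_lev_UNIV)
qed

text \<open>All components except the M-th lie in N = \<open>left_part H\<close>; the critical
  element only yields the pair (d + z, - z). By induction the first coordinates exhaust W, so N is
  normal, and N has index at most two because d is an involution.\<close>

lemma gen_orbit_through_critical: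
  assumes "cj (a 0) flip" "\<And>i. i \<noteq> M \<Longrightarrow> cj (a (Suc i)) (pair (a i) 0)"
    "cj (a (Suc M)) (pair (a M) 0 + flip)"
  shows "gen (range a \<union> lev n) = UNIV"
  using assms
proof (induction n arbitrary: a)
  case 0
  show ?case using gen_superset by fastforce
next
  case (Suc n)
  obtain w where w: "flip = conj_by w (a 0)" using Suc(2) cj_sym cj_def by blast
  define b where "b i = conj_by w (a i)" for i
  define H where "H = gen (range b \<union> lev (Suc n))"
  have H: "subgrp H" "lev (Suc n) \<subseteq> H" "\<And>i. b i \<in> H"
    unfolding H_def using gen_superset by (auto intro: subgrp_gen gen_base)
  have flip: "flip \<in> H" using H(3)[of 0] w by (simp add: b_def)
  let ?D = "{x. \<exists>y. pair x y \<in> H}"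
  have D: "subgrp ?D" using H(1) by (rule subgrp_fst)
  obtain d z where d: "cj d (a M)" and z: "b (Suc M) = pair (d + z) (- z) + flip"
    using Suc(4) cj_pair_flipE[of "b (Suc M)" "a M"] unfolding b_def by (metis cj_conj_by(1))
  then have dz: "pair (d + z) (- z) \<in> H"
    using H(3)[of "Suc M"] flip H(1) by (metis subgrp_add_right_iff)
  then have "d + z \<in> ?D" "- z \<in> ?D" using pair_swap_mem[OF H(1) flip] by blast+
  then have "(d + z) + - z \<in> ?D" using D subgrp_add by blast
  then have dD: "d \<in> ?D" by (simp add: add.assoc)
  have "\<exists>c. cj c (b i) \<and> (if i = M then c = d else c \<in> left_part H)" for i
    using left_part_cj_pair_zero[OF H(1) flip, of "b (Suc i)" "a i"] H(3) Suc(3)[of i] d by (auto simp: b_def)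
  then obtain c where c: "\<And>i. cj (c i) (b i)" "c M = d" "\<And>i. i \<noteq> M \<Longrightarrow> c i \<in> left_part H" by metis
  then have ca: "cj (c i) (a i)" for i by (simp add: b_def)
  have c0: "cj (c 0) flip" using Suc(2) ca cj_trans by blast
  have cS: "cj (c (Suc i)) (pair (c i) 0)" if "i \<noteq> M" for i
    using Suc(3) ca that by (meson cj_pairI cj_refl cj_sym cj_trans)
  have "cj (c (Suc M)) (pair (c M) 0 + flip)"
    using Suc(4) ca by (meson cj_pair_flipI cj_sym cj_trans)
  with c0 cS have full: "gen (range c \<union> lev n) = UNIV" by (rule Suc.IH)
  have "left_part H \<subseteq> ?D" by (auto simp: left_part_iff)
  moreover have "lev n \<subseteq> left_part H" using H(2) lev_subset_left_part by blast
  moreover have "c i \<in> ?D" for i using c(2) c(3)[of i] dD \<open>left_part H \<subseteq> ?D\<close> by (cases "i = M") auto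
  ultimately have "gen (range c \<union> lev n) \<subseteq> ?D" by (intro gen_least D) auto
  then have "\<And>x. \<exists>y. pair x y \<in> H" using full by auto
  then have normal: "conj_by x y \<in> left_part H \<longleftrightarrow> y \<in> left_part H" for x y
    using left_part_conj_by[OF H(1)] by blast
  have N: "subgrp (left_part H)" using H(1) by (rule subgrp_left_part)
  \<comment> \<open>Before the critical point each term arises from the flip by repeatedly forming
    (., 1), so it is an involution; d is the last of them.\<close>
  have "c i + c i = 0" if "i \<le> M" for i
    using that
  proof (induction i)
    case 0
    then show ?case using cj_involution[OF c0] flip_add_flip by simp
  next
    case (Suc i)
    then show ?case using cj_involution[OF cS[of i]] by (simp add: pair_add pair_zero)
  qed
  then have dd: "d + d = 0" using c(2) by auto
  then have md: "- d = d" by (rule minus_unique)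
  have "subgrp {x. x \<in> left_part H \<or> x + d \<in> left_part H}" (is "subgrp ?Q")
    using N normal dd by (intro subgrp_index_two) (auto simp: subgrp_0)
  then have "gen (range c \<union> lev n) \<subseteq> ?Q"
  proof (rule gen_least)
    have "c i \<in> ?Q" for i using c(2) c(3)[of i] dd N by (cases "i = M") (auto simp: subgrp_0)
    then show "range c \<union> lev n \<subseteq> ?Q" using \<open>lev n \<subseteq> left_part H\<close> by auto
  qed
  then have "z \<in> ?Q" using full by auto
  \<comment> \<open>The coordinates d + z and - z lie in N together or not at all. If d were outside
    N, exactly one of z and d + z would lie in N.\<close>
  then have dN: "d \<in> left_part H"
  proof
    assume "z \<in> left_part H \<or> z + d \<in> left_part H"
    then show ?thesis
    proof
      assume z: "z \<in> left_part H"
      then have "d + z \<in> left_part H" using left_part_pairD[OF H(1) flip dz] N by (simp add: subgrp_minus)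
      then show ?thesis using z N by (simp add: subgrp_add_right_iff)
    next
      assume z: "z + d \<in> left_part H"
      have "d + z = conj_by d (z + d)" by (simp only: conj_by_def grp_simps)
      then have "d + z \<in> left_part H" using z normal by simp
      then have "- z \<in> left_part H" using left_part_pairD[OF H(1) flip dz] by simp
      then have "z \<in> left_part H" using N by (simp add: subgrp_minus_iff)
      then show ?thesis using z N by (simp add: subgrp_add_left_iff)
    qed
  qed
  have "c i \<in> left_part H" for i using c(2,3) dN by (cases "i = M") auto
  then have "gen (range c \<union> lev n) \<subseteq> left_part H"
    using \<open>lev n \<subseteq> left_part H\<close> by (intro gen_least N) auto
  then have "H = UNIV" using left_part_UNIV[OF H(1) flip] full by auto
  then have "gen (conj_by w ` range a \<union> lev (Suc n)) = UNIV"
    by (simp add: H_def b_def image_image)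
  then show ?case by (simp only: gen_conj_by_lev_UNIV)
qed

text \<open>
  Two orbits starting at the critical values and merging after \<open>M + 1\<close> and \<open>N + 1\<close> steps.
\<close>

definition merging :: "nat \<Rightarrow> nat \<Rightarrow> (nat \<Rightarrow> tree_aut) \<Rightarrow> (nat \<Rightarrow> tree_aut) \<Rightarrow> bool" where
  "merging M N a c \<longleftrightarrow> cj (a 0) flip \<and> cj (c 0) flip \<and>
     (\<forall>i. i \<noteq> M \<longrightarrow> cj (a (Suc i)) (pair (a i) 0)) \<and>
     (\<forall>j<N. cj (c (Suc j)) (pair (c j) 0)) \<and>
     cj (a (Suc M)) (pair (a M) (c N))"

lemma merging_cong:
  assumes "merging M N a c" "\<And>i. cj (a' i) (a i)" "\<And>j. j \<le> N \<Longrightarrow> cj (c' j) (c j)"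
  shows "merging M N a' c'"
  using assms unfolding merging_def
  by (meson cj_pairI cj_refl cj_sym cj_trans less_imp_le_nat order_refl Suc_leI zero_le)

text \<open>Both orbits start with a conjugate of the flip and follow the same recursion until one
  of them reaches the merging point.\<close>

lemma merging_cj:
  assumes "merging M N a c" "i \<le> M" "i \<le> N"
  shows "cj (a i) (c i)"
  using assms(2,3)
proof (induction i)
  case 0
  then show ?case using assms(1) cj_sym cj_trans unfolding merging_def by blast
next
  case (Suc i)
  then have "cj (pair (a i) 0) (pair (c i) 0)" by (intro cj_pairI) auto
  moreover have "cj (a (Suc i)) (pair (a i) 0)" "cj (c (Suc i)) (pair (c i) 0)"
    using Suc.prems assms(1) by (auto simp: merging_def)
  ultimately show ?case using cj_sym cj_trans by blast
qed

text \<open>Induct on the level. Only the two components of the merging element are not obviously in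
  \<open>left_part H\<close>; by induction this subgroup is normal in W, and conjugacy with a point
  of the other orbit brings them in.\<close>

lemma gen_merging:
  assumes "merging M N a c" "M \<noteq> N"
  shows "gen (range a \<union> c ` {..N} \<union> lev n) = UNIV"
  using assms(1)
proof (induction n arbitrary: a c)
  case 0
  show ?case using gen_superset by fastforce
next
  case (Suc n)
  have "cj (a 0) flip" using Suc(2) by (simp add: merging_def)
  then obtain w where w: "flip = conj_by w (a 0)" using cj_sym cj_def by blast
  define b where "b i = conj_by w (a i)" for i
  define d where "d i = conj_by w (c i)" for i
  define H where "H = gen (range b \<union> d ` {..N} \<union> lev (Suc n))"
  have H: "subgrp H" "lev (Suc n) \<subseteq> H" "\<And>i. b i \<in> H" "\<And>j. j \<le> N \<Longrightarrow> d j \<in> H"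
    unfolding H_def using gen_superset by (auto intro: subgrp_gen gen_base)
  have flip: "flip \<in> H" using H(3)[of 0] w by (simp add: b_def)
  have bd: "merging M N b d" using Suc(2) by (rule merging_cong) (auto simp: b_def d_def)
  obtain a\<^sub>M c\<^sub>N where MN: "cj a\<^sub>M (b M)" "cj c\<^sub>N (d N)" "pair a\<^sub>M c\<^sub>N \<in> H"
  proof -
    have "cj (b (Suc M)) (pair (b M) (d N))" using bd by (simp add: merging_def)
    then show ?thesis using that H(3)[of "Suc M"] pair_swap_mem[OF H(1) flip] by (elim cj_pairE) auto
  qed
  have "\<exists>x. cj x (b i) \<and> (if i = M then x = a\<^sub>M else x \<in> left_part H)" for i
    using left_part_cj_pair_zero[OF H(1) flip H(3), of "Suc i" "b i"] bd MN(1)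
    unfolding merging_def by auto
  then obtain a' where a': "\<And>i. cj (a' i) (b i)" "a' M = a\<^sub>M" "\<And>i. i \<noteq> M \<Longrightarrow> a' i \<in> left_part H" by metis
  have "\<exists>x. cj x (d j) \<and> (if j = N then x = c\<^sub>N else x \<in> left_part H)" if "j \<le> N" for j
    using left_part_cj_pair_zero[OF H(1) flip H(4), of "Suc j" "d j"] bd MN(2) that
    unfolding merging_def by (cases "j = N") auto
  then obtain c' where c': "\<And>j. j \<le> N \<Longrightarrow> cj (c' j) (d j)" "c' N = c\<^sub>N"
      "\<And>j. j < N \<Longrightarrow> c' j \<in> left_part H"
    by (metis le_refl less_imp_le_nat less_irrefl_nat)
  have m: "merging M N a' c'" using bd a'(1) c'(1) by (rule merging_cong)
  then have full: "gen (range a' \<union> c' ` {..N} \<union> lev n) = UNIV" by (rule Suc.IH)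
  have N: "subgrp (left_part H)" using H(1) by (rule subgrp_left_part)
  let ?D = "{x. \<exists>y. pair x y \<in> H}"
  have sub: "left_part H \<subseteq> ?D" "lev n \<subseteq> left_part H"
    using H(2) lev_subset_left_part by (auto simp: left_part_iff)
  have "a' i \<in> ?D" for i using a'(2) a'(3)[of i] MN(3) sub by (cases "i = M") auto
  moreover have "c' j \<in> ?D" if "j \<le> N" for j
    using c'(2) c'(3)[of j] pair_swap_mem[OF H(1) flip MN(3)] sub that by (cases "j = N") auto
  ultimately have "gen (range a' \<union> c' ` {..N} \<union> lev n) \<subseteq> ?D"
    using sub by (intro gen_least subgrp_fst H) auto
  then have proj: "\<And>x. \<exists>y. pair x y \<in> H" using full by auto
  \<comment> \<open>It remains to bring in one of the two. The one with the smaller index is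
    conjugate to the point of equal index on the other orbit; as M and N differ, that point is not a
    merging one, so it lies in \<open>left_part H\<close>.\<close>
  have iff: "a\<^sub>M \<in> left_part H \<longleftrightarrow> c\<^sub>N \<in> left_part H"
    using left_part_pairD[OF H(1) flip MN(3)] .
  have "a\<^sub>M \<in> left_part H"
  proof (cases "M < N")
    case True
    then show ?thesis
      using cj_left_part[OF H(1) proj merging_cj[OF m, of M]] a'(2) c'(3) by simp
  next
    case False
    then have "N < M" using assms(2) by simp
    then have "cj (c' N) (a' N)" using merging_cj[OF m, of N] cj_sym by simp
    then have "c\<^sub>N \<in> left_part H"
      using cj_left_part[OF H(1) proj] a'(3)[of N] c'(2) \<open>N < M\<close> by simp
    then show ?thesis using iff by simp
  qed
  then have "a' i \<in> left_part H" for i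
    using a'(2) a'(3)[of i] by (cases "i = M") simp_all
  moreover have "c' j \<in> left_part H" if "j \<le> N" for j
    using c'(2) c'(3)[of j] that iff \<open>a\<^sub>M \<in> left_part H\<close> by (cases "j = N") simp_all
  ultimately have "gen (range a' \<union> c' ` {..N} \<union> lev n) \<subseteq> left_part H"
    using sub by (intro gen_least N) auto
  then have "H = UNIV" using left_part_UNIV[OF H(1) flip] full by auto
  then have "gen (conj_by w ` (range a \<union> c ` {..N}) \<union> lev (Suc n)) = UNIV"
    by (simp add: H_def b_def d_def image_image image_Un)
  then show ?case by (simp only: gen_conj_by_lev_UNIV)
qed

section \<open>Orbits merging simultaneously\<close>

text \<open>
  \<open>Inl i\<close> stands for the \<open>i\<close>-th point of the first orbit and \<open>Inr j\<close> for the \<open>j\<close>-th point of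
  the second one; both counts start at the critical values.
\<close>

definition idx :: "nat \<Rightarrow> (nat + nat) set" where
  "idx R = range Inl \<union> Inr ` {..R}"

lemma Inl_in_idx [simp]: "Inl i \<in> idx R"
  and Inr_in_idx [simp]: "Inr j \<in> idx R \<longleftrightarrow> j \<le> R"
  by (auto simp: idx_def)

definition system :: "nat \<Rightarrow> (nat + nat \<Rightarrow> tree_aut) \<Rightarrow> bool" where
  "system R b \<longleftrightarrow> merging R R (\<lambda>i. b (Inl i)) (\<lambda>j. b (Inr j))"

lemma system_cong: "system R b \<Longrightarrow> (\<And>p. p \<in> idx R \<Longrightarrow> cj (b' p) (b p)) \<Longrightarrow> system R b'"
  unfolding system_def by (erule merging_cong) auto

text \<open>Up to index R neither orbit has passed the merging point, so every element is built from
  the flip by forming (., 1).\<close>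

lemma system_involution:
  assumes "system R b" "i \<le> R"
  shows "b (Inl i) + b (Inl i) = 0" "b (Inr i) + b (Inr i) = 0"
proof -
  have "b (Inl i) + b (Inl i) = 0 \<and> b (Inr i) + b (Inr i) = 0"
    using assms(2)
  proof (induction i)
    case 0
    have "cj (b (Inl 0)) flip" "cj (b (Inr 0)) flip"
      using assms(1) by (auto simp: system_def merging_def)
    then show ?case using flip_add_flip cj_involution by blast
  next
    case (Suc i)
    then have "cj (b (Inl (Suc i))) (pair (b (Inl i)) 0)" "cj (b (Inr (Suc i))) (pair (b (Inr i)) 0)"
      using assms(1) by (auto simp: system_def merging_def)
    moreover have "b (Inl i) + b (Inl i) = 0" "b (Inr i) + b (Inr i) = 0" using Suc by auto
    ultimately show ?case by (auto simp: pair_add pair_zero dest!: cj_involution)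
  qed
  then show "b (Inl i) + b (Inl i) = 0" "b (Inr i) + b (Inr i) = 0" by auto
qed

text \<open>The order of the product is forgotten: only the existence of some arrangement matters.
  Letting the list contain any prescribed finite F ensures that the critical values and the merging
  point occur in it, and that the property descends to components.\<close>

definition prod_rel :: "nat \<Rightarrow> nat \<Rightarrow> (nat + nat \<Rightarrow> tree_aut) \<Rightarrow> bool" where
  "prod_rel R n b \<longleftrightarrow> (\<forall>F. finite F \<and> F \<subseteq> idx R \<longrightarrow>
     (\<exists>ps. distinct ps \<and> F \<subseteq> set ps \<and> set ps \<subseteq> idx R \<and> sum_list (map b ps) \<in> lev n))"

lemma prod_rel_conj_by: "prod_rel R n b \<Longrightarrow> prod_rel R n (\<lambda>p. conj_by w (b p))"
  unfolding prod_rel_def by (simp flip: conj_by_sum_list)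

text \<open>
  The last clause is what the product relation leaves behind one level lower: \<open>u\<close> is a product of
  components in which exactly one of the two that merge occurs, and only once.
\<close>

definition linked ::
  "nat \<Rightarrow> nat \<Rightarrow> (nat + nat \<Rightarrow> tree_aut) \<Rightarrow> (nat + nat \<Rightarrow> tree_aut) \<Rightarrow> bool" where
  "linked R n b d \<longleftrightarrow> b (Inl 0) = flip \<and>
     (\<forall>i. i \<noteq> R \<longrightarrow> b (Inl (Suc i)) = pair (d (Inl i)) 0 \<or> b (Inl (Suc i)) = pair 0 (d (Inl i))) \<and>
     (\<forall>j<R. b (Inr (Suc j)) = pair (d (Inr j)) 0 \<or> b (Inr (Suc j)) = pair 0 (d (Inr j))) \<and>
     (b (Inl (Suc R)) = pair (d (Inl R)) (d (Inr R)) \<or> b (Inl (Suc R)) = pair (d (Inr R)) (d (Inl R))) \<and>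
     d (Inl R) + d (Inl R) = 0 \<and> d (Inr R) + d (Inr R) = 0 \<and>
     (\<exists>u qs e. b (Inr 0) = pair u (- u) + flip \<and> u - sum_list (map d qs) \<in> lev n \<and>
        set qs \<subseteq> idx R \<and> filter (\<lambda>q. q = Inl R \<or> q = Inr R) qs = [e])"

text \<open>Diagonal elements (v, v) commute with the flip, so conjugation by them keeps the
  normalisation and conjugates all components by v.\<close>

lemma linked_conj_by:
  assumes "linked R n b d"
  shows "linked R n (\<lambda>p. conj_by (pair v v) (b p)) (\<lambda>p. conj_by v (d p))"
proof -
  obtain u qs e where u: "b (Inr 0) = pair u (- u) + flip" "u - sum_list (map d qs) \<in> lev n"
    "set qs \<subseteq> idx R" "filter (\<lambda>q. q = Inl R \<or> q = Inr R) qs = [e]"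
    using assms by (auto simp: linked_def)
  have "conj_by (pair v v) (b (Inr 0)) = pair (conj_by v u) (- conj_by v u) + flip"
    unfolding u by (simp only: conj_by_def grp_simps pair_simps)
  moreover have "conj_by v u - sum_list (map (\<lambda>p. conj_by v (d p)) qs) \<in> lev n"
    using u(2) by (simp flip: conj_by_sum_list conj_by_diff)
  moreover have "conj_by v (d p) + conj_by v (d p) = 0" if "d p + d p = 0" for p
    using that by (simp flip: conj_by_add)
  ultimately show ?thesis
    using assms u(3,4) unfolding linked_def
    by (auto simp: conj_by_pair conj_by_pair_of_flip)
qed

section \<open>Components along the two orbits\<close>

fun parent :: "nat \<Rightarrow> nat + nat \<Rightarrow> nat + nat" where
  "parent R (Inl i) = Inl (Suc i)"
| "parent R (Inr j) = (if j = R then Inl (Suc R) else Inr (Suc j))"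

text \<open>\<open>parent\<close> is the map f written in these indices, and \<open>children\<close>
  lists the preimages, that is, the indices of the components of the element at p. The point
  \<open>Inl (Suc R)\<close> has two; the critical values have none.\<close>

fun children :: "nat \<Rightarrow> nat + nat \<Rightarrow> (nat + nat) list" where
  "children R (Inl (Suc i)) = (if i = R then [Inl R, Inr R] else [Inl i])"
| "children R (Inr (Suc j)) = [Inr j]"
| "children R _ = []"

lemma children_parent:
  assumes "p \<in> idx R" "q \<in> set (children R p)"
  shows "parent R q = p" "q \<in> idx R"
  using assms by (cases "(R, p)" rule: children.cases; auto split: if_splits)+

lemma parent_in_idx: "q \<in> idx R \<Longrightarrow> parent R q \<in> idx R - {Inl 0, Inr 0}"
  by (cases q) auto

lemma in_children_parent: "q \<in> idx R \<Longrightarrow> q \<in> set (children R (parent R q))"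
  by (cases q) auto

text \<open>An index has only one parent, so it occurs among the children of only one p.\<close>

lemma distinct_concat_children:
  assumes "distinct L" "set L \<subseteq> idx R"
  shows "distinct (concat (map (children R) L))"
  using assms
proof (induction L)
  case (Cons p L)
  have "distinct (children R p)" by (cases "(R, p)" rule: children.cases) auto
  moreover have "set (children R p) \<inter> (\<Union>p'\<in>set L. set (children R p')) = {}"
  proof (rule ccontr)
    assume "\<not> ?thesis"
    then obtain p' q where q: "p' \<in> set L" "q \<in> set (children R p)" "q \<in> set (children R p')" by auto
    then have "parent R q = p" "parent R q = p'" using Cons.prems by (auto intro!: children_parent(1))
    then show False using q Cons.prems by auto
  qed
  ultimately show ?case using Cons by simp
qed auto

lemma rotate_to_front:
  assumes "distinct ps" "p \<in> set ps" "q \<in> set ps" "p \<noteq> q" "sum_list (map b ps) \<in> lev n"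
  obtains L1 L2 where "distinct (p # L1 @ q # L2)" "set (p # L1 @ q # L2) = set ps"
    "sum_list (map b (p # L1 @ q # L2)) \<in> lev n"
proof -
  obtain A B where ps: "ps = A @ p # B" using assms(2) by (auto simp: in_set_conv_decomp)
  then have "q \<in> set (B @ A)" using assms by auto
  then obtain L1 L2 where L: "B @ A = L1 @ q # L2" by (auto simp only: in_set_conv_decomp)
  have "sum_list (map b A) + sum_list (map b (p # B)) \<in> lev n" using assms(5) ps by simp
  then have "sum_list (map b (p # B)) + sum_list (map b A) \<in> lev n" by (rule lev_add_commute[THEN iffD1])
  then have "sum_list (map b (p # B @ A)) \<in> lev n" by (simp add: add.assoc)
  moreover have "distinct (p # B @ A)" "set (p # B @ A) = set ps" using assms(1) ps by auto
  ultimately show ?thesis unfolding L by (intro that) simp_all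
qed

lemma sum_list_pair:
  assumes "\<And>p. p \<in> set L \<Longrightarrow> b p = pair (sum_list (map d (\<alpha> p))) (sum_list (map d (\<beta> p)))"
  shows "sum_list (map b L) =
    pair (sum_list (map d (concat (map \<alpha> L)))) (sum_list (map d (concat (map \<beta> L))))"
  using assms by (induction L) (auto simp: pair_zero pair_add)

text \<open>Each coordinate is named after the preimage it belongs to. Its side stays open because
  conjugation may swap coordinates; at index R both names are taken from one and the same
  decomposition of the merging element.\<close>

lemma system_components:
  assumes "system R b"
  obtains d where "\<And>p. p \<in> idx R \<Longrightarrow> cj (d p) (b p)"
    "\<And>i. i \<noteq> R \<Longrightarrow> b (Inl (Suc i)) = pair (d (Inl i)) 0 \<or> b (Inl (Suc i)) = pair 0 (d (Inl i))"
    "\<And>j. j < R \<Longrightarrow> b (Inr (Suc j)) = pair (d (Inr j)) 0 \<or> b (Inr (Suc j)) = pair 0 (d (Inr j))"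
    "b (Inl (Suc R)) = pair (d (Inl R)) (d (Inr R)) \<or> b (Inl (Suc R)) = pair (d (Inr R)) (d (Inl R))"
proof -
  have s: "\<And>i. i \<noteq> R \<Longrightarrow> cj (b (Inl (Suc i))) (pair (b (Inl i)) 0)"
    "\<And>j. j < R \<Longrightarrow> cj (b (Inr (Suc j))) (pair (b (Inr j)) 0)"
    "cj (b (Inl (Suc R))) (pair (b (Inl R)) (b (Inr R)))"
    using assms by (auto simp: system_def merging_def)
  obtain x y where xy: "cj x (b (Inl R))" "cj y (b (Inr R))"
    "b (Inl (Suc R)) = pair x y \<or> b (Inl (Suc R)) = pair y x"
    using s(3) by (rule cj_pairE)
  have ex: "\<exists>z. cj z a \<and> (g = pair z 0 \<or> g = pair 0 z)" if "cj g (pair a 0)" for g a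
    using that by (elim cj_pairE) auto
  have "\<exists>z. cj z (b (Inl i)) \<and> (if i = R then z = x else
      b (Inl (Suc i)) = pair z 0 \<or> b (Inl (Suc i)) = pair 0 z)" for i
    using ex[OF s(1)[of i]] xy(1) by auto
  then obtain a where a: "\<And>i. cj (a i) (b (Inl i)) \<and> (if i = R then a i = x else
      b (Inl (Suc i)) = pair (a i) 0 \<or> b (Inl (Suc i)) = pair 0 (a i))" by metis
  have "\<exists>z. j \<le> R \<longrightarrow> cj z (b (Inr j)) \<and> (if j = R then z = y else
      b (Inr (Suc j)) = pair z 0 \<or> b (Inr (Suc j)) = pair 0 z)" for j
    using ex[OF s(2)[of j]] xy(2) by (cases "j < R") auto
  then obtain c where c: "\<And>j. j \<le> R \<Longrightarrow> cj (c j) (b (Inr j)) \<and> (if j = R then c j = y else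
      b (Inr (Suc j)) = pair (c j) 0 \<or> b (Inr (Suc j)) = pair 0 (c j))" by metis
  show ?thesis
  proof (rule that[of "case_sum a c"])
    fix p assume "p \<in> idx R"
    then show "cj (case_sum a c p) (b p)" using a c by (cases p) auto
  next
    fix i assume "i \<noteq> R"
    then show "b (Inl (Suc i)) = pair (case_sum a c (Inl i)) 0 \<or> b (Inl (Suc i)) = pair 0 (case_sum a c (Inl i))"
      using a[of i] by simp
  next
    fix j assume "j < R"
    then show "b (Inr (Suc j)) = pair (case_sum a c (Inr j)) 0 \<or> b (Inr (Suc j)) = pair 0 (case_sum a c (Inr j))"
      using c[of j] by simp
  next
    show "b (Inl (Suc R)) = pair (case_sum a c (Inl R)) (case_sum a c (Inr R)) \<or>
      b (Inl (Suc R)) = pair (case_sum a c (Inr R)) (case_sum a c (Inl R))"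
      using a[of R] c[of R] xy(3) by simp
  qed
qed

text \<open>
  The components \<open>d\<close> of a normalised system again satisfy the product relation, one level lower. After a cyclic
  rotation the relation reads \<open>flip (l, l') (u, - u) flip (m, m') = 1\<close>, which says
  \<open>u = m l'\<close> and \<open>l m l' m' = 1\<close>; in the latter product every component occurs exactly once.
\<close>

lemma exists_linked:
  assumes sys: "system R b" and b0: "b (Inl 0) = flip" and prod: "prod_rel R (Suc n) b"
  shows "\<exists>d. linked R n b d \<and> system R d \<and> prod_rel R n d"
proof -
  obtain d where cj: "\<And>p. p \<in> idx R \<Longrightarrow> cj (d p) (b p)"
    and dl: "\<And>i. i \<noteq> R \<Longrightarrow> b (Inl (Suc i)) = pair (d (Inl i)) 0 \<or> b (Inl (Suc i)) = pair 0 (d (Inl i))"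
    and dr: "\<And>j. j < R \<Longrightarrow> b (Inr (Suc j)) = pair (d (Inr j)) 0 \<or> b (Inr (Suc j)) = pair 0 (d (Inr j))"
    and dR: "b (Inl (Suc R)) = pair (d (Inl R)) (d (Inr R)) \<or> b (Inl (Suc R)) = pair (d (Inr R)) (d (Inl R))"
    using system_components[OF sys] by blast
  have sysd: "system R d" using sys cj by (rule system_cong)
  obtain u where u: "b (Inr 0) = pair u (- u) + flip"
    using sys by (auto simp: system_def merging_def elim: cj_flipE)
  define S where "S = idx R - {Inl 0, Inr 0}"
  \<comment> \<open>The children of p are split into those contributing to the left coordinate and
    those contributing to the right one; the merging point contributes one to each.\<close>
  have "\<exists>\<alpha> \<beta>. b p = pair (sum_list (map d \<alpha>)) (sum_list (map d \<beta>)) \<and>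
      mset (\<alpha> @ \<beta>) = mset (children R p) \<and> (p = Inl (Suc R) \<longrightarrow> length \<alpha> = 1 \<and> length \<beta> = 1)"
    if "p \<in> S" for p
  proof -
    consider i where "p = Inl (Suc i)" "i \<noteq> R" | "p = Inl (Suc R)" | j where "p = Inr (Suc j)" "j < R"
      using \<open>p \<in> S\<close> unfolding S_def
      by (cases "(R, p)" rule: children.cases) auto
    then show ?thesis
    proof cases
      case (1 i)
      from dl[OF 1(2)] show ?thesis
      proof
        assume "b (Inl (Suc i)) = pair (d (Inl i)) 0"
        then show ?thesis using 1 by (intro exI[of _ "[Inl i]"] exI[of _ "[]"]) auto
      next
        assume "b (Inl (Suc i)) = pair 0 (d (Inl i))"
        then show ?thesis using 1 by (intro exI[of _ "[Inl i]"] exI[of _ "[]"]) auto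
      qed
    next
      case 2
      from dR show ?thesis
      proof
        assume "b (Inl (Suc R)) = pair (d (Inl R)) (d (Inr R))"
        then show ?thesis using 2 by (intro exI[of _ "[Inl R]"] exI[of _ "[Inr R]"]) auto
      next
        assume "b (Inl (Suc R)) = pair (d (Inr R)) (d (Inl R))"
        then show ?thesis using 2 by (intro exI[of _ "[Inl R]"] exI[of _ "[Inr R]"]) auto
      qed
    next
      case (3 j)
      from dr[OF 3(2)] show ?thesis
      proof
        assume "b (Inr (Suc j)) = pair (d (Inr j)) 0"
        then show ?thesis using 3 by (intro exI[of _ "[Inr j]"] exI[of _ "[]"]) auto
      next
        assume "b (Inr (Suc j)) = pair 0 (d (Inr j))"
        then show ?thesis using 3 by (intro exI[of _ "[Inr j]"] exI[of _ "[]"]) auto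
      qed
    qed
  qed
  then obtain \<alpha> \<beta> where
    bp: "\<And>p. p \<in> S \<Longrightarrow> b p = pair (sum_list (map d (\<alpha> p))) (sum_list (map d (\<beta> p)))"
    and mset: "\<And>p. p \<in> S \<Longrightarrow> mset (\<alpha> p @ \<beta> p) = mset (children R p)"
    and len: "Inl (Suc R) \<in> S \<Longrightarrow> length (\<alpha> (Inl (Suc R))) = 1 \<and> length (\<beta> (Inl (Suc R))) = 1"
    by metis
  have sets: "set (\<alpha> p) \<union> set (\<beta> p) = set (children R p)" if "p \<in> S" for p
    using arg_cong[OF mset[OF that], of set_mset] by simp
  let ?R = "\<lambda>q. q = Inl R \<or> q = (Inr R :: nat + nat)"
  have main: "\<exists>qs qs' e. u - sum_list (map d qs) \<in> lev n \<and> set qs \<subseteq> idx R \<and> filter ?R qs = [e] \<and>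
      distinct qs' \<and> F \<subseteq> set qs' \<and> set qs' \<subseteq> idx R \<and> sum_list (map d qs') \<in> lev n"
    if F: "finite F" "F \<subseteq> idx R" for F
  proof -
    \<comment> \<open>The parents of F make F occur among the components, the critical values allow
      the rotation, and the merging point supplies the single marked component of u.\<close>
    let ?F = "{Inl 0, Inr 0, Inl (Suc R)} \<union> parent R ` F"
    have "finite ?F" "?F \<subseteq> idx R" using F parent_in_idx by auto
    then obtain ps where ps: "distinct ps" "?F \<subseteq> set ps" "set ps \<subseteq> idx R" "sum_list (map b ps) \<in> lev (Suc n)"
      using prod[unfolded prod_rel_def, rule_format, of ?F] by blast
    then have "Inl 0 \<in> set ps" "Inr 0 \<in> set ps" "Inl 0 \<noteq> (Inr 0 :: nat + nat)" by auto
    then obtain L1 L2 where L: "distinct (Inl 0 # L1 @ Inr 0 # L2)" "set (Inl 0 # L1 @ Inr 0 # L2) = set ps"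
      "sum_list (map b (Inl 0 # L1 @ Inr 0 # L2)) \<in> lev (Suc n)"
      using rotate_to_front ps(1,4) by metis
    have LS: "set L1 \<subseteq> S" "set L2 \<subseteq> S" "Inl (Suc R) \<in> set L1 \<union> set L2" "parent R ` F \<subseteq> set L1 \<union> set L2"
    proof -
      show "set L1 \<subseteq> S" "set L2 \<subseteq> S" unfolding S_def using L(1,2) ps(3) by auto
      have "set ps - {Inl 0, Inr 0} \<subseteq> set L1 \<union> set L2" using L(2) by auto
      then show "Inl (Suc R) \<in> set L1 \<union> set L2" "parent R ` F \<subseteq> set L1 \<union> set L2"
        using ps(2) F(2) parent_in_idx by fastforce+
    qed
    define A B where "A L = concat (map \<alpha> L)" and "B L = concat (map \<beta> L)" for L
    define l l' m m' where "l = sum_list (map d (A L1))" and "l' = sum_list (map d (B L1))"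
      and "m = sum_list (map d (A L2))" and "m' = sum_list (map d (B L2))"
    have "sum_list (map b L1) = pair l l'" "sum_list (map b L2) = pair m m'"
      unfolding l_def l'_def m_def m'_def A_def B_def using bp LS(1,2) by (intro sum_list_pair; blast)+
    then have "flip + (pair l l' + (pair u (- u) + flip + pair m m')) \<in> lev (Suc n)"
      using L(3) by (simp add: b0 u)
    also have "flip + (pair l l' + (pair u (- u) + flip + pair m m')) =
        pair (l' + (- u + m)) (l + u + m')"
      by (simp only: grp_simps pair_simps)
    finally have lm: "l' + (- u + m) \<in> lev n" "l + u + m' \<in> lev n" by auto
    then have k: "- u + (m + l') \<in> lev n"
      using lev_add_commute[of l' "- u + m"] by (simp add: add.assoc)
    have "- (- u + (m + l')) \<in> lev n" using k by (simp only: subgrp_minus_iff[OF subgrp_lev])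
    then have u_lev: "u - (m + l') \<in> lev n"
      using lev_add_commute[of u "- (m + l')"] by (simp only: grp_simps)
    \<comment> \<open>Substitutes m l' for u in the right coordinate by inserting the relation in
      front of m'.\<close>
    have "(l + u + m') + conj_by (- m') (- u + (m + l')) \<in> lev n"
      using k by (intro subgrp_add[OF subgrp_lev lm(2)]) (simp only: lev_conj_by)
    moreover have "(l + u + m') + conj_by (- m') (- u + (m + l')) = l + m + l' + m'"
      by (simp only: conj_by_def grp_simps)
    ultimately have prod': "l + m + l' + m' \<in> lev n" by simp
    let ?qs' = "A L1 @ A L2 @ B L1 @ B L2"
    have "mset (A L @ B L) = mset (concat (map (children R) L))" if "set L \<subseteq> S" for L
      using that
    proof (induction L)
      case (Cons p L)
      then have "mset (\<alpha> p) + mset (\<beta> p) = mset (children R p)" using mset[of p] by simp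
      then show ?case using Cons by (simp add: A_def B_def ac_simps)
    qed (simp add: A_def B_def)
    moreover have "mset ?qs' = mset (A L1 @ B L1) + mset (A L2 @ B L2)" by (simp add: ac_simps)
    ultimately have qs': "mset ?qs' = mset (concat (map (children R) (L1 @ L2)))" using LS(1,2) by simp
    have "distinct (concat (map (children R) (L1 @ L2)))"
      using L(1) LS(1,2) by (intro distinct_concat_children) (auto simp: S_def)
    then have dist: "distinct ?qs'" using qs' mset_eq_imp_distinct_iff by blast
    have set_qs': "set ?qs' = (\<Union>p\<in>set L1 \<union> set L2. set (children R p))"
      using arg_cong[OF qs', of set_mset] by auto
    then have sub: "set ?qs' \<subseteq> idx R" using LS(1,2) children_parent(2) by (force simp: S_def)
    have FS: "F \<subseteq> set ?qs'" unfolding set_qs' using F(2) LS(4) in_children_parent by blast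
    have R_free: "filter ?R (A L) = []" "filter ?R (B L) = []"
      if "set L \<subseteq> S" "Inl (Suc R) \<notin> set L" for L
    proof -
      have "\<not> ?R q" if "p \<in> set L" "q \<in> set (children R p)" for p q
      proof
        assume "?R q"
        then have "parent R q = Inl (Suc R)" by auto
        moreover have "parent R q = p"
          using that \<open>set L \<subseteq> S\<close> by (intro children_parent(1)) (auto simp: S_def)
        ultimately show False using that \<open>Inl (Suc R) \<notin> set L\<close> by simp
      qed
      then show "filter ?R (A L) = []" "filter ?R (B L) = []"
        unfolding filter_empty_conv A_def B_def using sets \<open>set L \<subseteq> S\<close> by fastforce+
    qed
    have sR: "Inl (Suc R) \<in> S" by (simp add: S_def)
    have R_one: "\<exists>e. filter ?R (A L) = [e]" "\<exists>e. filter ?R (B L) = [e]"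
      if LSub: "set L \<subseteq> S" "distinct L" "Inl (Suc R) \<in> set L" for L
    proof -
      obtain X Y where XY: "L = X @ Inl (Suc R) # Y" using LSub(3) by (auto simp: in_set_conv_decomp)
      then have "filter ?R (A X) = []" "filter ?R (A Y) = []" "filter ?R (B X) = []" "filter ?R (B Y) = []"
        using LSub by (auto intro!: R_free)
      moreover obtain e f where ef: "\<alpha> (Inl (Suc R)) = [e]" "\<beta> (Inl (Suc R)) = [f]"
        using len[OF sR] by (auto simp: length_Suc_conv)
      moreover have "?R e" "?R f" using sets[OF sR] ef by auto
      ultimately show "\<exists>e. filter ?R (A L) = [e]" "\<exists>e. filter ?R (B L) = [e]"
        unfolding A_def B_def XY by auto
    qed
    \<comment> \<open>The merging point lies in only one of the segments L1 and L2 and gives one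
      component to each side of it. Here only one side of each segment is taken, so just one of the
      two components appears.\<close>
    have "\<exists>e. filter ?R (A L2 @ B L1) = [e]"
    proof (cases "Inl (Suc R) \<in> set L1")
      case True
      then have "Inl (Suc R) \<notin> set L2" using L(1) by auto
      then show ?thesis using R_free[OF LS(2)] R_one[OF LS(1) _ True] L(1) by auto
    next
      case False
      then have "Inl (Suc R) \<in> set L2" using LS(3) by auto
      then show ?thesis using R_free[OF LS(1) False] R_one[OF LS(2)] L(1) by auto
    qed
    then obtain e where e: "filter ?R (A L2 @ B L1) = [e]" by blast
    have "u - sum_list (map d (A L2 @ B L1)) \<in> lev n" using u_lev by (simp add: m_def l'_def)
    moreover have "sum_list (map d ?qs') \<in> lev n" using prod'
      by (simp add: l_def l'_def m_def m'_def add.assoc)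
    moreover have "set (A L2 @ B L1) \<subseteq> idx R" using sub by auto
    ultimately show ?thesis using e dist FS sub by blast
  qed
  have "prod_rel R n d"
    unfolding prod_rel_def
  proof (intro allI impI)
    fix F assume "finite F \<and> F \<subseteq> idx R"
    with main[of F] obtain qs' where
      "distinct qs' \<and> F \<subseteq> set qs' \<and> set qs' \<subseteq> idx R \<and> sum_list (map d qs') \<in> lev n"
      by (elim conjE exE meta_impE) auto
    then show "\<exists>ps. distinct ps \<and> F \<subseteq> set ps \<and> set ps \<subseteq> idx R \<and> sum_list (map d ps) \<in> lev n" ..
  qed
  moreover have "linked R n b d"
  proof -
    obtain qs e where "u - sum_list (map d qs) \<in> lev n" "set qs \<subseteq> idx R" "filter ?R qs = [e]"
      using main[of "{}"] by auto
    then have "\<exists>u qs e. b (Inr 0) = pair u (- u) + flip \<and> u - sum_list (map d qs) \<in> lev n \<and>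
        set qs \<subseteq> idx R \<and> filter ?R qs = [e]"
      using u by blast
    then show ?thesis
      unfolding linked_def using b0 dl dr dR system_involution[OF sysd, of R] by blast
  qed
  ultimately show ?thesis using sysd by blast
qed

text \<open>Write a, c for the merging components and N for \<open>left_part H\<close>; all other
  components lie in N. Modulo N, u is one of a and c, say e, so H contains (e, e). Together with (a,
  c) this gives (a, a), (c, c) and a c in N. Hence H contains the diagonal of G, G normalises N, and
  N and its coset by c cover G.\<close>

lemma linked_facts:
  assumes lk: "linked R n b d"
  defines "H \<equiv> gen (b ` idx R \<union> lev (Suc n))" and "G \<equiv> gen (d ` idx R \<union> lev n)" and "c \<equiv> d (Inr R)"
  shows "flip \<in> H" "lev n \<subseteq> left_part H"
    "\<And>p. p \<in> idx R - {Inl R, Inr R} \<Longrightarrow> d p \<in> left_part H"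
    "d (Inl R) + c \<in> left_part H" "c + c = 0"
    "\<And>x. x \<in> G \<Longrightarrow> pair x x \<in> H"
    "\<And>x y. x \<in> G \<Longrightarrow> conj_by x y \<in> left_part H \<longleftrightarrow> y \<in> left_part H"
    "\<And>x. x \<in> G \<Longrightarrow> x \<in> left_part H \<or> x + c \<in> left_part H"
proof -
  let ?N = "left_part H" and ?a = "d (Inl R)"
  have H: "subgrp H" "lev (Suc n) \<subseteq> H" "\<And>p. p \<in> idx R \<Longrightarrow> b p \<in> H"
    unfolding H_def using gen_superset by (auto intro: subgrp_gen gen_base)
  have N: "subgrp ?N" using H(1) by (rule subgrp_left_part)
  show flip: "flip \<in> H" using lk H(3)[of "Inl 0"] by (simp add: linked_def)
  show levN: "lev n \<subseteq> ?N" using H(2) by (rule lev_subset_left_part)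
  have swap: "pair x y \<in> H \<Longrightarrow> pair y x \<in> H" for x y using H(1) flip by (rule pair_swap_mem)
  show dN: "d p \<in> ?N" if "p \<in> idx R - {Inl R, Inr R}" for p
  proof (cases p)
    case (Inl i)
    then show ?thesis using lk that H(3)[of "Inl (Suc i)"] swap by (auto simp: linked_def left_part_iff)
  next
    case (Inr j)
    then have "j < R" using that by (auto simp: order_less_le)
    then show ?thesis using Inr lk H(3)[of "Inr (Suc j)"] swap by (auto simp: linked_def left_part_iff)
  qed
  have aa: "?a + ?a = 0" and cc: "c + c = 0" using lk by (auto simp: linked_def c_def)
  show "c + c = 0" by (rule cc)
  have ac: "pair ?a c \<in> H" "pair c ?a \<in> H"
    using lk H(3)[of "Inl (Suc R)"] swap unfolding linked_def c_def by auto
  obtain u qs e where u: "b (Inr 0) = pair u (- u) + flip" "u - sum_list (map d qs) \<in> lev n"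
    "set qs \<subseteq> idx R" "filter (\<lambda>q. q = Inl R \<or> q = Inr R) qs = [e]"
    using lk by (auto simp: linked_def)
  obtain q1 q2 where qs: "qs = q1 @ e # q2" and e: "e = Inl R \<or> e = Inr R"
    and q1: "\<forall>q\<in>set q1. \<not> (q = Inl R \<or> q = Inr R)" and q2: "[] = filter (\<lambda>q. q = Inl R \<or> q = Inr R) q2"
    using u(4) unfolding filter_eq_Cons_iff by blast
  have "\<forall>q\<in>set q2. \<not> (q = Inl R \<or> q = Inr R)" using q2[symmetric] unfolding filter_empty_conv .
  then have q: "q \<noteq> Inl R \<and> q \<noteq> Inr R" if "q \<in> set q1 \<union> set q2" for q
    using that q1 by blast
  \<comment> \<open>z1 also absorbs the error in \<open>lev n\<close>, so that u = z1 + d e + z2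
    holds exactly.\<close>
  define z1 where "z1 = (u - sum_list (map d qs)) + sum_list (map d q1)"
  define z2 where "z2 = sum_list (map d q2)"
  have z2: "z2 \<in> ?N" unfolding z2_def using q u(3) qs by (intro subgrp_sum_list[OF N] dN) auto
  have "sum_list (map d q1) \<in> ?N" using q u(3) qs by (intro subgrp_sum_list[OF N] dN) auto
  then have z1: "z1 \<in> ?N" unfolding z1_def using u(2) levN by (intro subgrp_add[OF N]) auto
  have uz: "u = z1 + d e + z2" unfolding z1_def z2_def qs
    by (simp only: map_append list.map sum_list_append sum_list.Cons grp_simps)
  have ee: "d e + d e = 0" using e aa cc by (auto simp: c_def)
  then have me: "- d e = d e" by (rule minus_unique)
  have "pair u (- u) \<in> H" using u(1) H(1) H(3)[of "Inr 0"] flip by (simp add: subgrp_add_right_iff)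
  \<comment> \<open>Both z1 and z2 lie in N and can be stripped from the two coordinates separately;
    the remaining pair is diagonal because d e is an involution.\<close>
  then have "pair (- z1) 0 + pair 0 z2 + pair u (- u) + pair (- z2) 0 + pair 0 z1 \<in> H"
    using z1 z2 N right_part_mem[OF H(1) flip]
    by (intro subgrp_add[OF H(1)]) (auto simp flip: left_part_iff simp: subgrp_minus)
  moreover have "pair (- z1) 0 + pair 0 z2 + pair u (- u) + pair (- z2) 0 + pair 0 z1 = pair (d e) (- d e)"
    unfolding uz by (simp only: grp_simps pair_simps)
  ultimately have pe: "pair (d e) (d e) \<in> H" by (simp add: me)
  have "pair c c \<in> H \<and> pair ?a ?a \<in> H \<and> ?a + c \<in> ?N"
    using e
  proof
    assume e: "e = Inl R"
    then have "pair ?a ?a + pair ?a c \<in> H" using pe ac by (auto intro: subgrp_add[OF H(1)])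
    then have *: "pair 0 (?a + c) \<in> H" by (simp add: pair_add aa)
    then have "pair c ?a + pair 0 (?a + c) \<in> H" using ac by (auto intro: subgrp_add[OF H(1)])
    moreover have "?a + (?a + c) = c" using aa by (simp flip: add.assoc)
    ultimately show ?thesis using pe e swap[OF *] by (auto simp: pair_add left_part_iff)
  next
    assume e: "e = Inr R"
    then have "pair c c \<in> H" using pe by (simp add: c_def)
    then have 1: "pair ?a c + pair c c \<in> H" and 2: "pair c c + pair c ?a \<in> H"
      using ac by (auto intro: subgrp_add[OF H(1)])
    have *: "pair (?a + c) 0 \<in> H" "pair 0 (c + ?a) \<in> H" using 1 2 by (simp_all add: pair_add cc)
    then have "pair ?a c + pair 0 (c + ?a) \<in> H" using ac by (auto intro: subgrp_add[OF H(1)])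
    moreover have "c + (c + ?a) = ?a" using cc by (simp flip: add.assoc)
    ultimately show ?thesis using \<open>pair c c \<in> H\<close> * by (auto simp: pair_add left_part_iff)
  qed
  then have pc: "pair c c \<in> H" and pa: "pair ?a ?a \<in> H" and acN: "?a + c \<in> ?N" by auto
  show "?a + c \<in> ?N" by (rule acN)
  have NH: "pair x x \<in> H" if "x \<in> ?N" for x
  proof -
    have "pair x 0 + pair 0 x \<in> H"
      using that right_part_mem[OF H(1) flip] by (intro subgrp_add[OF H(1)]) (auto simp: left_part_iff)
    then show ?thesis by (simp add: pair_add)
  qed
  have "subgrp {x. pair x x \<in> H}"
  proof (rule subgrpI)
    show "0 \<in> {x. pair x x \<in> H}" using H(1) by (simp add: pair_zero subgrp_0)
  next
    fix x y assume "x \<in> {x. pair x x \<in> H}" "y \<in> {x. pair x x \<in> H}"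
    then show "x + y \<in> {x. pair x x \<in> H}" using subgrp_add[OF H(1), of "pair x x" "pair y y"] by (simp add: pair_add)
  next
    fix x assume "x \<in> {x. pair x x \<in> H}"
    then show "- x \<in> {x. pair x x \<in> H}" using subgrp_minus[OF H(1), of "pair x x"] by (simp add: pair_minus)
  qed
  moreover have "pair (d p) (d p) \<in> H" if "p \<in> idx R" for p
    using that dN[of p] NH pc pa unfolding c_def by (cases "p = Inl R \<or> p = Inr R") auto
  ultimately have "G \<subseteq> {x. pair x x \<in> H}" unfolding G_def using levN NH by (intro gen_least) auto
  then show GH: "\<And>x. x \<in> G \<Longrightarrow> pair x x \<in> H" by auto
  then show conj: "\<And>x y. x \<in> G \<Longrightarrow> conj_by x y \<in> ?N \<longleftrightarrow> y \<in> ?N"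
    using left_part_conj_by[OF H(1)] by blast
  have "c \<in> G" unfolding G_def c_def by (rule gen_base) simp
  then have "subgrp {x. x \<in> ?N \<or> x + c \<in> ?N}"
    using N conj cc by (intro subgrp_index_two) (auto simp: subgrp_0)
  moreover have "d p \<in> ?N \<or> d p + c \<in> ?N" if "p \<in> idx R" for p
    using that dN[of p] acN cc N unfolding c_def by (cases "p = Inl R \<or> p = Inr R") (auto simp: subgrp_0)
  ultimately have "G \<subseteq> {x. x \<in> ?N \<or> x + c \<in> ?N}" unfolding G_def using levN by (intro gen_least) auto
  then show "\<And>x. x \<in> G \<Longrightarrow> x \<in> ?N \<or> x + c \<in> ?N" by auto
qed

text \<open>Flips in H first bring the two coordinates of g and g' into matching order; then (y, z)
  does the conjugation.\<close>

lemma pair_conj_close: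
  assumes "subgrp H" "flip \<in> H" "pair y z \<in> H"
    and g: "g = pair e f \<or> g = pair f e" and g': "g' = pair e' f' \<or> g' = pair f' e'"
    and "e' - conj_by y e \<in> lev n" "f' - conj_by z f \<in> lev n"
  shows "\<exists>x\<in>H. g' - conj_by x g \<in> lev (Suc n)"
proof -
  have "\<exists>s\<in>H. conj_by s g = pair e f" using g
  proof
    assume "g = pair e f"
    then show ?thesis using assms(1) by (intro bexI[of _ 0]) (auto simp: subgrp_0)
  next
    assume "g = pair f e"
    then show ?thesis using assms(2) by (intro bexI[of _ flip]) (auto simp: conj_by_flip)
  qed
  then obtain s where s: "s \<in> H" "conj_by s g = pair e f" by blast
  have "\<exists>t\<in>H. conj_by t (pair e' f') = g'" using g'
  proof
    assume "g' = pair e' f'"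
    then show ?thesis using assms(1) by (intro bexI[of _ 0]) (auto simp: subgrp_0)
  next
    assume "g' = pair f' e'"
    then show ?thesis using assms(2) by (intro bexI[of _ flip]) (auto simp: conj_by_flip)
  qed
  then obtain t where t: "t \<in> H" "conj_by t (pair e' f') = g'" by blast
  have "g' - conj_by (t + (pair y z + s)) g = conj_by t (pair (e' - conj_by y e) (f' - conj_by z f))"
    by (simp only: t(2)[symmetric] conj_by_conj_by[symmetric] s(2) conj_by_pair[of y z]
        conj_by_diff[symmetric] pair_diff)
  then have "g' - conj_by (t + (pair y z + s)) g \<in> lev (Suc n)"
    using assms(6,7) by simp
  moreover have "t + (pair y z + s) \<in> H" using s(1) t(1) assms(1,3) by (intro subgrp_add)
  ultimately show ?thesis by blast
qed

text \<open>Conjugating elements for the components must be lifted to H. At a point with one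
  component the diagonal lift (x, x) works. The merging point and the second critical value need the
  index-two description of N.\<close>

lemma linked_step:
  assumes lk: "linked R n b d" and lk': "linked R n b' d'"
    and sim: "\<And>p. p \<in> idx R \<Longrightarrow> \<exists>x\<in>gen (d ` idx R \<union> lev n). d' p - conj_by x (d p) \<in> lev n"
    and p: "p \<in> idx R"
  shows "\<exists>x\<in>gen (b ` idx R \<union> lev (Suc n)). b' p - conj_by x (b p) \<in> lev (Suc n)"
proof -
  define H where "H = gen (b ` idx R \<union> lev (Suc n))"
  define G where "G = gen (d ` idx R \<union> lev n)"
  define c where "c = d (Inr R)"
  let ?N = "left_part H"
  have H: "subgrp H" and G: "subgrp G" unfolding H_def G_def by (rule subgrp_gen)+
  have N: "subgrp ?N" using H by (rule subgrp_left_part)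
  note facts = linked_facts[OF lk, folded H_def G_def c_def]
  note flip = facts(1) and levN = facts(2) and dN = facts(3) and acN = facts(4) and cc = facts(5)
    and GH = facts(6) and GN = facts(7) and G_cases = facts(8)
  have mc: "- c = c" using cc by (rule minus_unique)
  have cG: "c \<in> G" unfolding G_def c_def by (rule gen_base) simp
  have simG: "\<exists>x\<in>G. d' p - conj_by x (d p) \<in> lev n" if "p \<in> idx R" for p
    using sim[OF that] by (simp add: G_def)
  \<comment> \<open>The nontrivial coset of N is stable under conjugation by G, since the quotient
    has order at most two.\<close>
  have conj_c: "conj_by x y + c \<in> ?N" if x: "x \<in> G" and y: "y + c \<in> ?N" for x y
  proof -
    have "conj_by x c + c \<in> ?N"
      using G_cases[OF x]
    proof
      assume "x \<in> ?N"
      then have "x + conj_by c (- x) \<in> ?N"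
        by (intro subgrp_add[OF N]) (simp_all only: GN[OF cG] subgrp_minus_iff[OF N])
      moreover have "x + conj_by c (- x) = conj_by x c + - c" by (simp only: conj_by_def grp_simps)
      ultimately show ?thesis by (simp only: mc)
    next
      assume "x + c \<in> ?N"
      then have "(x + c) + conj_by c (- (x + c)) \<in> ?N"
        by (intro subgrp_add[OF N \<open>x + c \<in> ?N\<close>]) (simp only: GN[OF cG] subgrp_minus_iff[OF N])
      moreover have "(x + c) + conj_by c (- (x + c)) = conj_by x c + - c" by (simp only: conj_by_def grp_simps)
      ultimately show ?thesis by (simp only: mc)
    qed
    moreover have "conj_by x (y + c) \<in> ?N" using GN[OF x] y by simp
    ultimately have "conj_by x (y + c) + (conj_by x c + c) \<in> ?N" by (blast intro: subgrp_add[OF N])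
    moreover have "conj_by x (y + c) + (conj_by x c + c) = conj_by x y + (conj_by x (c + c) + c)"
      by (simp only: conj_by_add add.assoc)
    ultimately show ?thesis by (simp add: cc)
  qed
  have d'N: "d' p \<in> ?N" if p: "p \<in> idx R - {Inl R, Inr R}" for p
  proof -
    obtain x where x: "x \<in> G" "d' p - conj_by x (d p) \<in> lev n" using p simG[of p] by blast
    then have "(d' p - conj_by x (d p)) + conj_by x (d p) \<in> ?N"
      using dN[OF p] GN[OF x(1)] levN by (intro subgrp_add[OF N]) auto
    then show ?thesis by simp
  qed
  have d'R: "d' p + c \<in> ?N" if p: "p = Inl R \<or> p = Inr R" for p
  proof -
    obtain x where x: "x \<in> G" "d' p - conj_by x (d p) \<in> lev n" using p simG[of p] by auto
    have "d p + c \<in> ?N" using p acN cc N by (auto simp: c_def subgrp_0)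
    from conj_c[OF x(1) this] have "(d' p - conj_by x (d p)) + (conj_by x (d p) + c) \<in> ?N"
      using x(2) levN by (blast intro: subgrp_add[OF N])
    then show ?thesis by (simp flip: add.assoc)
  qed
  \<comment> \<open>One factor lies in the coset of c and all others lie in N, so the product lies
    in that coset, for either of the two systems.\<close>
  have odd_sum: "u + c \<in> ?N"
    if odd: "u - sum_list (map g qs) \<in> lev n" "set qs \<subseteq> idx R" "filter (\<lambda>q. q = Inl R \<or> q = Inr R) qs = [e]"
      "\<And>p. p \<in> idx R - {Inl R, Inr R} \<Longrightarrow> g p \<in> ?N" "\<And>p. p = Inl R \<or> p = Inr R \<Longrightarrow> g p + c \<in> ?N"
    for u g qs and e :: "nat + nat"
  proof -
    obtain q1 q2 where qs: "qs = q1 @ e # q2" and e: "e = Inl R \<or> e = Inr R"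
      and q1: "\<forall>q\<in>set q1. \<not> (q = Inl R \<or> q = Inr R)" and q2: "[] = filter (\<lambda>q. q = Inl R \<or> q = Inr R) q2"
      using odd(3) unfolding filter_eq_Cons_iff by blast
    have "\<forall>q\<in>set q2. \<not> (q = Inl R \<or> q = Inr R)" using q2[symmetric] unfolding filter_empty_conv .
    then have q: "q \<in> idx R - {Inl R, Inr R}" if "q \<in> set q1 \<union> set q2" for q
      using that q1 \<open>set qs \<subseteq> idx R\<close> qs by auto
    have 1: "sum_list (map g q1) \<in> ?N" and 2: "sum_list (map g q2) \<in> ?N"
      using q by (auto intro!: subgrp_sum_list[OF N] odd(4))
    have "u - sum_list (map g qs) \<in> ?N" "conj_by c (sum_list (map g q2)) \<in> ?N"
      using odd(1) levN GN[OF cG] 2 by auto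
    then have "(u - sum_list (map g qs)) + sum_list (map g q1) + (g e + c) + conj_by c (sum_list (map g q2)) \<in> ?N"
      using 1 odd(5)[OF e] by (blast intro: subgrp_add[OF N])
    moreover have "(u - sum_list (map g qs)) + sum_list (map g q1) + (g e + c) + conj_by (- c) (sum_list (map g q2)) = u + c"
      unfolding qs by (simp only: map_append list.map sum_list_append sum_list.Cons conj_by_def grp_simps)
    ultimately show ?thesis by (simp only: mc)
  qed
  have "\<exists>x\<in>H. b' p - conj_by x (b p) \<in> lev (Suc n)"
  proof (cases p)
    case (Inl k)
    show ?thesis
    proof (cases k)
      case 0
      then show ?thesis using Inl lk lk' H
        by (intro bexI[of _ 0]) (auto simp: linked_def subgrp_0 subgrp_0[OF subgrp_lev])
    next
      case (Suc i)
      show ?thesis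
      proof (cases "i = R")
        case False
        obtain x where x: "x \<in> G" "d' (Inl i) - conj_by x (d (Inl i)) \<in> lev n"
          using simG[of "Inl i"] by auto
        have "b p = pair (d (Inl i)) 0 \<or> b p = pair 0 (d (Inl i))"
          "b' p = pair (d' (Inl i)) 0 \<or> b' p = pair 0 (d' (Inl i))"
          using lk lk' False Inl Suc by (auto simp: linked_def)
        then show ?thesis
          using pair_conj_close[OF H flip GH[OF x(1)] _ _ x(2), of "b p" 0 "b' p" 0]
          by (simp add: subgrp_0[OF subgrp_lev])
      next
        case True
        obtain y where y: "y \<in> G" "d' (Inl R) - conj_by y (d (Inl R)) \<in> lev n"
          using simG[of "Inl R"] by auto
        obtain z where z: "z \<in> G" "d' (Inr R) - conj_by z c \<in> lev n"
          using simG[of "Inr R"] by (auto simp: c_def)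
        \<comment> \<open>(y, z) lies in H if z^-1 y lies in N. Otherwise z is replaced by z c,
          which conjugates c in the same way and changes the coset.\<close>
        have "\<exists>z. pair y z \<in> H \<and> d' (Inr R) - conj_by z c \<in> lev n"
        proof -
          have "- z + y \<in> G" using y z G by (auto intro: subgrp_add subgrp_minus)
          then consider "- z + y \<in> ?N" | "(- z + y) + c \<in> ?N" using G_cases by blast
          then show ?thesis
          proof cases
            case 1
            then have "pair z z + pair (- z + y) 0 \<in> H"
              using GH[OF z(1)] by (intro subgrp_add[OF H]) (simp_all add: left_part_iff)
            then have "pair y z \<in> H" by (simp add: pair_add)
            then show ?thesis using z(2) by blast
          next
            case 2
            then have "conj_by c ((- z + y) + c) \<in> ?N" using GN[OF cG] by simp
            moreover have "conj_by c ((- z + y) + c) = c + (- z + y)" by (simp only: conj_by_def grp_simps)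
            ultimately have "- c + (- z + y) \<in> ?N" by (simp only: mc)
            moreover have "z + c \<in> G" using z cG G by (simp add: subgrp_add)
            ultimately have "pair (z + c) (z + c) + pair (- c + (- z + y)) 0 \<in> H"
              using GH by (intro subgrp_add[OF H]) (simp_all add: left_part_iff)
            then have "pair y (z + c) \<in> H" by (simp add: pair_add add.assoc)
            moreover have "conj_by (z + c) c = conj_by z c"
              by (simp only: conj_by_def grp_simps)
            ultimately show ?thesis using z(2) by metis
          qed
        qed
        then obtain z' where z': "pair y z' \<in> H" "d' (Inr R) - conj_by z' c \<in> lev n" by blast
        have "b p = pair (d (Inl R)) c \<or> b p = pair c (d (Inl R))"
          "b' p = pair (d' (Inl R)) (d' (Inr R)) \<or> b' p = pair (d' (Inr R)) (d' (Inl R))"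
          using lk lk' True Inl Suc by (auto simp: linked_def c_def)
        then show ?thesis by (rule pair_conj_close[OF H flip z'(1) _ _ y(2) z'(2)])
      qed
    qed
  next
    case (Inr k)
    show ?thesis
    proof (cases k)
      case 0
      obtain u qs e where u: "b (Inr 0) = pair u (- u) + flip" "u - sum_list (map d qs) \<in> lev n"
        "set qs \<subseteq> idx R" "filter (\<lambda>q. q = Inl R \<or> q = Inr R) qs = [e]"
        using lk by (auto simp: linked_def)
      obtain u' qs' e' where u': "b' (Inr 0) = pair u' (- u') + flip" "u' - sum_list (map d' qs') \<in> lev n"
        "set qs' \<subseteq> idx R" "filter (\<lambda>q. q = Inl R \<or> q = Inr R) qs' = [e']"
        using lk' by (auto simp: linked_def)
      have "d p + c \<in> ?N" if "p = Inl R \<or> p = Inr R" for p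
        using that acN cc N by (auto simp: c_def subgrp_0)
      then have "u + c \<in> ?N" using odd_sum[OF u(2-4)] dN by blast
      moreover have "u' + c \<in> ?N" using odd_sum[OF u'(2-4)] d'N d'R by blast
      ultimately have "(u' + c) - (u + c) \<in> ?N" by (intro subgrp_diff[OF N])
      moreover have "(u' + c) - (u + c) = u' - u" by (simp only: grp_simps)
      ultimately have "pair (u' - u) 0 \<in> H" by (simp add: left_part_iff)
      \<comment> \<open>Conjugation by (u' u^-1, 1) carries one element exactly to the other; it is
        available in H because u and u' lie in the same coset of N.\<close>
      moreover have "b' p = conj_by (pair (u' - u) 0) (b p)"
        unfolding Inr 0 u(1) u'(1) by (simp only: conj_by_def grp_simps pair_simps)
      ultimately show ?thesis by (intro bexI) (simp_all add: subgrp_0[OF subgrp_lev])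
    next
      case (Suc j)
      then have j: "j < R" using p Inr by simp
      obtain x where x: "x \<in> G" "d' (Inr j) - conj_by x (d (Inr j)) \<in> lev n"
        using simG[of "Inr j"] j by auto
      have "b p = pair (d (Inr j)) 0 \<or> b p = pair 0 (d (Inr j))"
        "b' p = pair (d' (Inr j)) 0 \<or> b' p = pair 0 (d' (Inr j))"
        using lk lk' j Inr Suc by (auto simp: linked_def)
      then show ?thesis
        using pair_conj_close[OF H flip GH[OF x(1)] _ _ x(2), of "b p" 0 "b' p" 0]
        by (simp add: subgrp_0[OF subgrp_lev])
    qed
  qed
  then show ?thesis by (simp add: H_def)
qed

section \<open>Comparison of two systems level by level\<close>

definition equivalent :: "nat \<Rightarrow> nat \<Rightarrow> (nat + nat \<Rightarrow> tree_aut) \<Rightarrow> (nat + nat \<Rightarrow> tree_aut) \<Rightarrow> bool" where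
  "equivalent R n b b' \<longleftrightarrow> gen (b ` idx R \<union> lev n) = gen (b' ` idx R \<union> lev n) \<and>
     (\<forall>p\<in>idx R. \<exists>x\<in>gen (b ` idx R \<union> lev n). b' p - conj_by x (b p) \<in> lev n)"

lemma close_sym:
  assumes "b' - conj_by x b \<in> lev n"
  shows "b - conj_by (- x) b' \<in> lev n"
proof -
  have "conj_by (- x) (- (b' - conj_by x b)) \<in> lev n"
    using assms by (simp only: lev_conj_by subgrp_minus_iff[OF subgrp_lev])
  moreover have "conj_by (- x) (- (b' - conj_by x b)) = b - conj_by (- x) b'"
    by (simp only: conj_by_def grp_simps)
  ultimately show ?thesis by (simp only:)
qed

lemma equivalent_sym: "equivalent R n b b' \<Longrightarrow> equivalent R n b' b"
  unfolding equivalent_def using close_sym subgrp_minus[OF subgrp_gen] by (metis (no_types, lifting))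

lemma equivalent_conj_by:
  assumes "equivalent R n b b'"
  shows "equivalent R n (\<lambda>p. conj_by w (b p)) (\<lambda>p. conj_by w (b' p))"
proof -
  have *: "gen ((\<lambda>p. conj_by w (g p)) ` idx R \<union> lev n) = conj_by w ` gen (g ` idx R \<union> lev n)" for g :: "nat + nat \<Rightarrow> tree_aut"
    using gen_conj_by_lev[of w "g ` idx R" n] by (simp add: image_image)
  show ?thesis
    unfolding equivalent_def *
  proof (intro conjI ballI)
    show "conj_by w ` gen (b ` idx R \<union> lev n) = conj_by w ` gen (b' ` idx R \<union> lev n)"
      using assms by (simp add: equivalent_def)
  next
    fix p assume "p \<in> idx R"
    then obtain x where x: "x \<in> gen (b ` idx R \<union> lev n)" "b' p - conj_by x (b p) \<in> lev n"
      using assms by (auto simp: equivalent_def)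
    have "conj_by w (b' p) - conj_by (conj_by w x) (conj_by w (b p)) = conj_by w (b' p - conj_by x (b p))"
      by (simp only: conj_by_def grp_simps)
    then show "\<exists>x\<in>conj_by w ` gen (b ` idx R \<union> lev n). conj_by w (b' p) - conj_by x (conj_by w (b p)) \<in> lev n"
      using x by (intro bexI[of _ "conj_by w x"]) auto
  qed
qed

text \<open>The generated groups agree automatically: each generator of one differs by an element of
  \<open>lev n\<close> from a conjugate formed inside the other.\<close>

lemma equivalentI:
  assumes "\<And>p. p \<in> idx R \<Longrightarrow> \<exists>x\<in>gen (b ` idx R \<union> lev n). b' p - conj_by x (b p) \<in> lev n"
    and "\<And>p. p \<in> idx R \<Longrightarrow> \<exists>x\<in>gen (b' ` idx R \<union> lev n). b p - conj_by x (b' p) \<in> lev n"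
  shows "equivalent R n b b'"
proof -
  have sub: "gen (g' ` idx R \<union> lev n) \<subseteq> gen (g ` idx R \<union> lev n)"
    if sim: "\<And>p. p \<in> idx R \<Longrightarrow> \<exists>x\<in>gen (g ` idx R \<union> lev n). g' p - conj_by x (g p) \<in> lev n"
    for g g' :: "nat + nat \<Rightarrow> tree_aut"
  proof (rule gen_least[OF subgrp_gen], rule Un_least)
    show "lev n \<subseteq> gen (g ` idx R \<union> lev n)" using gen_superset by blast
    show "g' ` idx R \<subseteq> gen (g ` idx R \<union> lev n)"
    proof (rule image_subsetI)
      fix p assume p: "p \<in> idx R"
      obtain x where x: "x \<in> gen (g ` idx R \<union> lev n)" "g' p - conj_by x (g p) \<in> lev n"
        using sim[OF p] by blast
      have "(g' p - conj_by x (g p)) + conj_by x (g p) \<in> gen (g ` idx R \<union> lev n)"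
        using x p by (intro gen_add subgrp_conj_by[OF subgrp_gen]) (auto intro: gen_base)
      then show "g' p \<in> gen (g ` idx R \<union> lev n)" by simp
    qed
  qed
  show ?thesis unfolding equivalent_def using assms(1) sub[of b b'] sub[of b' b] assms by blast
qed

text \<open>Induct on the level: normalise both systems to start with the flip, apply the induction
  hypothesis to the components, and lift with \<open>linked_step\<close> in both directions.\<close>

lemma systems_equivalent:
  assumes "system R b" "system R b'" "prod_rel R n b" "prod_rel R n b'"
  shows "\<exists>v. equivalent R n (\<lambda>p. conj_by v (b p)) b'"
  using assms
proof (induction n arbitrary: b b')
  case 0
  have "gen (S \<union> UNIV) = UNIV" for S :: "tree_aut set" using gen_superset by blast
  then show ?case by (auto simp: equivalent_def)
next
  case (Suc n)
  have normal: "\<exists>w d. linked R n (\<lambda>p. conj_by w (g p)) d \<and> system R d \<and> prod_rel R n d"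
    if g: "system R g" "prod_rel R (Suc n) g" for g
  proof -
    have "cj flip (g (Inl 0))" using g(1) by (auto simp: system_def merging_def cj_sym)
    then obtain w where w: "flip = conj_by w (g (Inl 0))" by (auto simp: cj_def)
    have "system R (\<lambda>p. conj_by w (g p))" using g(1) by (rule system_cong) simp
    then show ?thesis
      using exists_linked[of R "\<lambda>p. conj_by w (g p)" n] w prod_rel_conj_by[OF g(2)] by auto
  qed
  obtain w d where d: "linked R n (\<lambda>p. conj_by w (b p)) d" "system R d" "prod_rel R n d"
    using normal[OF Suc.prems(1,3)] by blast
  obtain w' d' where d': "linked R n (\<lambda>p. conj_by w' (b' p)) d'" "system R d'" "prod_rel R n d'"
    using normal[OF Suc.prems(2,4)] by blast
  obtain v where v: "equivalent R n (\<lambda>p. conj_by v (d p)) d'" using Suc.IH[OF d(2) d'(2) d(3) d'(3)] by blast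
  note v' = equivalent_sym[OF v]
  \<comment> \<open>The diagonal element (v, v) realises the conjugation of the components by v
    without disturbing the flip.\<close>
  let ?g = "\<lambda>p. conj_by (pair v v) (conj_by w (b p))"
  have g: "linked R n ?g (\<lambda>p. conj_by v (d p))" by (rule linked_conj_by[OF d(1)])
  have "equivalent R (Suc n) ?g (\<lambda>p. conj_by w' (b' p))"
    using v v' linked_step[OF g d'(1)] linked_step[OF d'(1) g]
    unfolding equivalent_def by (intro equivalentI[unfolded equivalent_def]) blast+
  from equivalent_conj_by[OF this, of "- w'"]
  have "equivalent R (Suc n) (\<lambda>p. conj_by (- w' + (pair v v + w)) (b p)) b'"
    by (simp add: conj_by_conj_by)
  then show ?case by blast
qed

section \<open>Closed subgroups\<close>

lemma lev_diff_iff: "- g + h \<in> lev n \<longleftrightarrow> (\<forall>t. length t \<le> n \<longrightarrow> app h t = app g t)"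
proof -
  have "app (- g + h) t = t \<longleftrightarrow> app h t = app g t" for t
  proof -
    have "app (- g + h) t = t \<longleftrightarrow> app (g + (- g + h)) t = app g t" by (simp only: app_add app_eq_iff)
    then show ?thesis by (simp only: add_minus_cancel)
  qed
  then show ?thesis by (simp add: lev_iff)
qed

text \<open>On words of length at most n the sequence is constant from index n on, so reading off
  the value at index \<open>length t\<close> defines the limit.\<close>

lemma coherent_limit:
  assumes "\<And>n. - s n + s (Suc n) \<in> lev n"
  obtains v where "\<And>n. - s n + v \<in> lev n"
proof -
  have *: "app (s (n + k)) t = app (s n) t" if "length t \<le> n" for n k t
  proof (induction k)
    case (Suc k)
    have "app (s (Suc (n + k))) t = app (s (n + k)) t"
      using assms[of "n + k"] that by (simp add: lev_diff_iff)
    then show ?case using Suc by simp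
  qed simp
  define g where "g t = app (s (length t)) t" for t
  have "inj g"
  proof (rule injI)
    fix t t' assume gt: "g t = g t'"
    have "length t = length t'" using arg_cong[OF gt, of length] by (simp add: g_def)
    then show "t = t'" using gt by (simp add: g_def)
  qed
  moreover have "surj g"
  proof -
    have "t = g (app (- s (length t)) t)" for t
    proof -
      have "app (s (length t)) (app (- s (length t)) t) = t"
        by (simp only: right_minus app_zero flip: app_add)
      then show ?thesis by (simp add: g_def)
    qed
    then show ?thesis by (rule surjI[OF sym])
  qed
  moreover have "g [] = []" by (simp add: g_def)
  moreover have "\<exists>y. g (t @ [x]) = g t @ [y]" for t x
  proof -
    have "\<exists>y. app (s (Suc (length t))) (t @ [x]) = app (s (Suc (length t))) t @ [y]"
      using app[of "s (Suc (length t))"] by (auto simp: carrier_treeW_iff)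
    then show ?thesis using *[of t "length t" 1] by (simp add: g_def)
  qed
  ultimately have "g \<in> carrier treeW" by (auto simp: carrier_treeW_iff bij_def)
  then have v: "app (Tree_Aut g) = g" by (rule Tree_Aut_inverse)
  have "- s n + Tree_Aut g \<in> lev n" for n
    unfolding lev_diff_iff v g_def using * by (metis le_add_diff_inverse order_refl)
  then show ?thesis by (rule that)
qed

text \<open>A Koenig argument: each V n is a nonempty union of cosets of \<open>lev n\<close>, and a
  branch of nested cosets meeting all V m is followed to its limit.\<close>

lemma compactness:
  assumes ne: "\<And>n. V n \<noteq> {}" and dec: "\<And>n. V (Suc n) \<subseteq> V n"
    and sat: "\<And>n v w. v \<in> V n \<Longrightarrow> - v + w \<in> lev n \<Longrightarrow> w \<in> V n"
  shows "\<exists>v. \<forall>n. v \<in> V n"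
proof -
  have dec': "V n \<subseteq> V m" if "m \<le> n" for m n
    using that dec by (rule lift_Suc_antimono_le[of V, rotated])
  define P where "P n x \<longleftrightarrow> (\<forall>m. \<exists>y\<in>V m. - x + y \<in> lev n)" for n x
  have "\<exists>x'. P (Suc n) x' \<and> - x + x' \<in> lev n" if P: "P n x" for n x
  proof -
    obtain F where F: "finite F" "\<And>g. \<exists>h\<in>F. - h + g \<in> lev (Suc n)" using lev_finite_index by meson
    \<comment> \<open>Pigeonhole: if each of the finitely many subcosets missed some V m, the
      largest such m would contradict the choice of x, as the V m decrease.\<close>
    have "\<exists>h\<in>F. \<forall>m. \<exists>y\<in>V m. - x + y \<in> lev n \<and> - h + y \<in> lev (Suc n)"
    proof (rule ccontr)
      assume "\<not> ?thesis"
      then obtain m where m: "\<And>h. h \<in> F \<Longrightarrow> \<not> (\<exists>y\<in>V (m h). - x + y \<in> lev n \<and> - h + y \<in> lev (Suc n))"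
        by metis
      define M where "M = Max (insert 0 (m ` F))"
      obtain y where y: "y \<in> V M" "- x + y \<in> lev n" using P unfolding P_def by blast
      obtain h where h: "h \<in> F" "- h + y \<in> lev (Suc n)" using F(2) by blast
      have "m h \<le> M" unfolding M_def using F(1) h(1) by (intro Max_ge) auto
      then show False using m[OF h(1)] y h(2) dec' by blast
    qed
    then obtain h where h: "\<And>m. \<exists>y\<in>V m. - x + y \<in> lev n \<and> - h + y \<in> lev (Suc n)" by blast
    obtain y where "- x + y \<in> lev n" "- h + y \<in> lev (Suc n)" using h by blast
    then have "- x + h \<in> lev n" by (auto simp: lev_diff_iff)
    then show ?thesis using h unfolding P_def by blast
  qed
  moreover have "P 0 0" using ne by (auto simp: P_def)
  ultimately obtain s where s: "\<And>n. P n (s n)" "\<And>n. - s n + s (Suc n) \<in> lev n"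
    using dependent_nat_choice[of P "\<lambda>n x x'. - x + x' \<in> lev n"] by metis
  obtain v where v: "\<And>n. - s n + v \<in> lev n" using coherent_limit s(2) by blast
  have "v \<in> V n" for n
  proof -
    obtain y where y: "y \<in> V n" "- s n + y \<in> lev n" using s(1)[of n] unfolding P_def by blast
    then have "- y + v \<in> lev n" using v[of n] by (simp add: lev_diff_iff)
    then show ?thesis using y(1) sat by blast
  qed
  then show ?thesis by blast
qed

text \<open>As \<open>lev n\<close> is normal, the group generated is the product of
  \<open>gen S\<close> and \<open>lev n\<close>. The intersection over all n is therefore the
  closure of \<open>gen S\<close>.\<close>

lemma gen_lev_iff: "g \<in> gen (S \<union> lev n) \<longleftrightarrow> (\<exists>a\<in>gen S. - g + a \<in> lev n)"
proof
  assume "g \<in> gen (S \<union> lev n)"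
  then show "\<exists>a\<in>gen S. - g + a \<in> lev n"
  proof induction
    case gen_zero
    then show ?case by (intro bexI[of _ 0]) (auto intro: gen.gen_zero simp: subgrp_0[OF subgrp_lev])
  next
    case (gen_base x)
    then show ?case
    proof
      assume "x \<in> S"
      then show ?thesis by (intro bexI[of _ x]) (auto intro: gen.gen_base simp: subgrp_0[OF subgrp_lev])
    next
      assume "x \<in> lev n"
      then show ?thesis by (intro bexI[of _ 0]) (auto intro: gen.gen_zero simp: subgrp_minus[OF subgrp_lev])
    qed
  next
    case (gen_add x y)
    then obtain a b where "a \<in> gen S" "- x + a \<in> lev n" "b \<in> gen S" "- y + b \<in> lev n" by blast
    then have "(- y + b) + conj_by (- b) (- x + a) \<in> lev n"
      by (intro subgrp_add[OF subgrp_lev \<open>- y + b \<in> lev n\<close>]) (simp only: lev_conj_by)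
    moreover have "(- y + b) + conj_by (- b) (- x + a) = - (x + y) + (a + b)"
      by (simp only: conj_by_def grp_simps)
    ultimately show ?case using \<open>a \<in> gen S\<close> \<open>b \<in> gen S\<close>
      by (intro bexI[of _ "a + b"]) (auto intro: gen.gen_add)
  next
    case (gen_minus x)
    then obtain a where a: "a \<in> gen S" "- x + a \<in> lev n" by blast
    then have "conj_by x (- (- x + a)) \<in> lev n" by (simp only: lev_conj_by subgrp_minus[OF subgrp_lev])
    moreover have "conj_by x (- (- x + a)) = - (- x) + - a" by (simp only: conj_by_def grp_simps)
    ultimately show ?case using a by (intro bexI[of _ "- a"]) (auto intro: gen.gen_minus)
  qed
next
  assume "\<exists>a\<in>gen S. - g + a \<in> lev n"
  then obtain a where a: "a \<in> gen S" "- g + a \<in> lev n" by blast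
  have "a \<in> gen (S \<union> lev n)" using a(1) gen_mono[of S "S \<union> lev n"] by blast
  moreover have "- g + a \<in> gen (S \<union> lev n)" using a(2) by (intro gen.gen_base) simp
  ultimately have "a + - (- g + a) \<in> gen (S \<union> lev n)" by (blast intro: gen.gen_add gen.gen_minus)
  moreover have "a + - (- g + a) = g" by (simp only: grp_simps)
  ultimately show "g \<in> gen (S \<union> lev n)" by simp
qed

lemma gen_gen_lev: "gen (S \<union> lev n) = gen (gen (S \<union> lev (Suc n)) \<union> lev n)"
proof (intro equalityI gen_least subgrp_gen)
  show "S \<union> lev n \<subseteq> gen (gen (S \<union> lev (Suc n)) \<union> lev n)"
    by (auto intro: gen_base)
  have "gen (S \<union> lev (Suc n)) \<subseteq> gen (S \<union> lev n)"
    using lev_Suc_subset by (intro gen_mono) auto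
  then show "gen (S \<union> lev (Suc n)) \<union> lev n \<subseteq> gen (S \<union> lev n)"
    by (auto intro: gen_base)
qed

text \<open>The conjugating elements for level n form a decreasing sequence of unions of cosets of
  \<open>lev n\<close>, so one element serves all levels.\<close>

lemma conjugate_closures:
  assumes "\<And>n. \<exists>v. gen (S \<union> lev n) = conj_by v ` gen (T \<union> lev n)"
  shows "\<exists>v. {g. \<forall>n. g \<in> gen (S \<union> lev n)} = conj_by v ` {g. \<forall>n. g \<in> gen (T \<union> lev n)}"
proof -
  define V where "V n = {v. gen (S \<union> lev n) = conj_by v ` gen (T \<union> lev n)}" for n
  have "\<exists>v. \<forall>n. v \<in> V n"
  proof (rule compactness)
    show "V n \<noteq> {}" for n using assms by (auto simp: V_def)
  next
    fix n show "V (Suc n) \<subseteq> V n"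
    proof
      fix v assume "v \<in> V (Suc n)"
      then have "gen (gen (S \<union> lev (Suc n)) \<union> lev n) = conj_by v ` gen (gen (T \<union> lev (Suc n)) \<union> lev n)"
        by (simp add: V_def gen_conj_by_lev)
      then show "v \<in> V n" by (simp add: V_def flip: gen_gen_lev)
    qed
  next
    fix n v w assume v: "v \<in> V n" and vw: "- v + w \<in> lev n"
    have T: "- v + w \<in> gen (T \<union> lev n)" using vw by (auto intro: gen_base)
    have "conj_by w ` gen (T \<union> lev n) = conj_by v ` conj_by (- v + w) ` gen (T \<union> lev n)"
      by (simp add: image_image conj_by_conj_by)
    \<comment> \<open>An element of the group itself normalises it.\<close>
    also have "conj_by (- v + w) ` gen (T \<union> lev n) = gen (T \<union> lev n)"
    proof (intro equalityI subsetI)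
      fix x assume "x \<in> conj_by (- v + w) ` gen (T \<union> lev n)"
      then show "x \<in> gen (T \<union> lev n)" using T subgrp_conj_by[OF subgrp_gen] by blast
    next
      fix x assume "x \<in> gen (T \<union> lev n)"
      then have "conj_by (- (- v + w)) x \<in> gen (T \<union> lev n)"
        using T by (intro subgrp_conj_by subgrp_minus subgrp_gen)
      then show "x \<in> conj_by (- v + w) ` gen (T \<union> lev n)" by (metis conj_by_inverse(2) image_eqI)
    qed
    finally show "w \<in> V n" using v by (simp add: V_def)
  qed
  then obtain v where v: "\<And>n. gen (S \<union> lev n) = conj_by v ` gen (T \<union> lev n)" by (auto simp: V_def)
  have "g \<in> conj_by v ` {g. \<forall>n. g \<in> gen (T \<union> lev n)}" if "\<And>n. g \<in> gen (S \<union> lev n)" for g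
  proof -
    have "conj_by (- v) g \<in> gen (T \<union> lev n)" for n
      using that[of n] v by auto
    then show ?thesis by (intro image_eqI[of _ _ "conj_by (- v) g"]) simp_all
  qed
  then have "{g. \<forall>n. g \<in> gen (S \<union> lev n)} = conj_by v ` {g. \<forall>n. g \<in> gen (T \<union> lev n)}"
    using v by auto
  then show ?thesis by blast
qed

section \<open>Translation to the record \<open>treeW\<close> and its topology\<close>

lemma restrict_app_eq_iff:
  "restrict (app g) (tree_level n) = restrict (app h) (tree_level n) \<longleftrightarrow> - g + h \<in> lev n"
  unfolding lev_diff_iff tree_level_def
  by (auto simp: fun_eq_iff restrict_def)

lemma carrier_eq_range_app: "carrier treeW = range app"
  using app Tree_Aut_inverse by (auto simp: image_iff) metis

lemma closure_of_app:
  "treeW_topology closure_of (app ` A) = app ` {g. \<forall>n. \<exists>a\<in>A. - g + a \<in> lev n}"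
proof -
  define B where "B h n = {g \<in> carrier treeW. restrict g (tree_level n) = restrict h (tree_level n)}"
    for h n
  define BB where "BB = {B h n |h n. h \<in> carrier treeW}"
  have top: "treeW_topology = topology_generated_by BB"
    by (simp add: treeW_topology_def BB_def B_def)
  have mem_B: "app g \<in> B (app h) n \<longleftrightarrow> - g + h \<in> lev n" for g h n
    using app by (auto simp: B_def restrict_app_eq_iff)
  have B_open: "openin treeW_topology (B (app g) n)" for g n
    unfolding top by (rule topology_generated_by_Basis) (use app in \<open>auto simp: BB_def\<close>)
  have space: "topspace treeW_topology = range app"
    unfolding top topology_generated_by_topspace BB_def B_def carrier_eq_range_app by auto
  \<comment> \<open>Finite intersections of subbasic sets again contain a coset of some
    \<open>lev n\<close>, namely for the larger of the two levels.\<close>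
  have nbhd: "\<exists>n. \<forall>h. - g + h \<in> lev n \<longrightarrow> app h \<in> T" if "openin treeW_topology T" "app g \<in> T" for g T
  proof -
    have "generate_topology_on BB T" using that(1) by (simp add: top openin_topology_generated_by_iff)
    then show ?thesis using that(2)
    proof (induction T)
      case Empty
      then show ?case by simp
    next
      case (Int a b)
      then obtain m n where "\<forall>h. - g + h \<in> lev m \<longrightarrow> app h \<in> a" "\<forall>h. - g + h \<in> lev n \<longrightarrow> app h \<in> b"
        by blast
      then show ?case by (intro exI[of _ "max m n"]) (auto simp: lev_diff_iff)
    next
      case (UN K)
      then show ?case by blast
    next
      case (Basis s)
      then obtain h n where s: "s = B (app h) n" by (auto simp: BB_def carrier_eq_range_app)
      then have "- g + h \<in> lev n" using Basis mem_B by simp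
      then show ?case unfolding s mem_B by (intro exI[of _ n]) (auto simp: lev_diff_iff)
    qed
  qed
  show ?thesis
  proof (intro equalityI subsetI)
    fix x assume x: "x \<in> treeW_topology closure_of (app ` A)"
    then obtain g where g: "x = app g" using space by (auto simp: in_closure_of)
    have "\<exists>a\<in>A. - g + a \<in> lev n" for n
    proof -
      have "app g \<in> B (app g) n" by (simp add: mem_B subgrp_0[OF subgrp_lev])
      then obtain a where "a \<in> A" "app a \<in> B (app g) n"
        using x B_open[of g n] unfolding g in_closure_of by blast
      then show ?thesis unfolding mem_B by (intro bexI[of _ a]) (auto simp: lev_diff_iff)
    qed
    then show "x \<in> app ` {g. \<forall>n. \<exists>a\<in>A. - g + a \<in> lev n}" using g by blast
  next
    fix x assume "x \<in> app ` {g. \<forall>n. \<exists>a\<in>A. - g + a \<in> lev n}"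
    then obtain g where g: "x = app g" "\<And>n. \<exists>a\<in>A. - g + a \<in> lev n" by blast
    have "\<exists>y. y \<in> app ` A \<and> y \<in> T" if "x \<in> T" "openin treeW_topology T" for T
      using nbhd[of T g] that g by blast
    then show "x \<in> treeW_topology closure_of (app ` A)" using g(1) space by (auto simp: in_closure_of)
  qed
qed

lemma mult_treeW_app: "app g \<otimes>\<^bsub>treeW\<^esub> app h = app (g + h)"
  by (simp add: treeW_def plus_tree_aut.rep_eq)

lemma one_treeW_app: "\<one>\<^bsub>treeW\<^esub> = app 0"
  by (simp add: treeW_def zero_tree_aut.rep_eq)

lemma inv_treeW_app: "inv\<^bsub>treeW\<^esub> (app g) = app (- g)"
  by (rule group.inv_equality[OF group_treeW]) (auto simp: mult_treeW_app one_treeW_app app)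

lemma conj_W_app_iff: "app g \<sim>\<^sub>W app h \<longleftrightarrow> cj g h"
  unfolding conj_W_def cj_def carrier_eq_range_app
  by (auto simp: inv_treeW_app mult_treeW_app app_inject conj_by_def)

lemma sigma_app: "sigma = app flip"
  by (simp add: flip.rep_eq)

lemma tree_pair_app: "tree_pair (app u) (app v) = app (pair u v)"
  by (simp add: pair.rep_eq)

lemma generate_app: "generate treeW (app ` S) = app ` gen S"
proof (intro equalityI subsetI)
  fix x assume "x \<in> generate treeW (app ` S)"
  then show "x \<in> app ` gen S"
  proof induction
    case one
    show ?case unfolding one_treeW_app by (intro imageI gen.gen_zero)
  next
    case (incl h)
    then show ?case by (auto intro: gen.intros)
  next
    case (inv h)
    then show ?case by (auto simp: inv_treeW_app intro!: imageI gen.gen_minus intro: gen.gen_base)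
  next
    case (eng h1 h2)
    then obtain x y where "h1 = app x" "h2 = app y" "x \<in> gen S" "y \<in> gen S" by blast
    then show ?case by (simp only: mult_treeW_app imageI gen.gen_add)
  qed
next
  have "app g \<in> generate treeW (app ` S)" if "g \<in> gen S" for g
    using that
  proof induction
    case gen_zero
    show ?case using generate.one[of treeW] by (simp only: one_treeW_app)
  next
    case (gen_base x)
    then show ?case by (simp add: generate.incl)
  next
    case (gen_add x y)
    then show ?case using generate.eng by (fastforce simp flip: mult_treeW_app)
  next
    case (gen_minus x)
    have "app ` S \<subseteq> carrier treeW" using app by blast
    then show ?case
      using group.generate_m_inv_closed[OF group_treeW _ gen_minus(2)] by (simp add: inv_treeW_app)
  qed
  then show "x \<in> generate treeW (app ` S)" if "x \<in> app ` gen S" for x using that by blast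
qed

lemma subgroups_conj_W_app: "A = conj_by v ` B \<Longrightarrow> subgroups_conj_W (app ` A) (app ` B)"
  unfolding subgroups_conj_W_def
  using app by (intro bexI[of _ "app v"])
    (auto simp: image_image inv_treeW_app mult_treeW_app conj_by_def)

section \<open>Postcritical orbits\<close>

text \<open>The type conditions in \<open>tree_aut\<close>, indexed by the preimage instead of by
  the image point.\<close>

definition typed :: "('x \<Rightarrow> 'x) \<Rightarrow> 'x set \<Rightarrow> ('x \<Rightarrow> tree_aut) \<Rightarrow> bool" where
  "typed f C \<beta> \<longleftrightarrow> (let P = postcritical f C in
     (\<forall>c\<in>C - P. cj (\<beta> (f c)) flip) \<and>
     (\<forall>c\<in>C \<inter> P. cj (\<beta> (f c)) (pair (\<beta> c) 0 + flip)) \<and>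
     (\<forall>q\<in>P - C. (\<forall>r\<in>P - C. f r = f q \<longrightarrow> r = q) \<longrightarrow> cj (\<beta> (f q)) (pair (\<beta> q) 0)) \<and>
     (\<forall>q\<in>P - C. \<forall>q'\<in>P - C. q \<noteq> q' \<and> f q = f q' \<longrightarrow> cj (\<beta> (f q)) (pair (\<beta> q) (\<beta> q'))))"

lemma postcritical_image: "c \<in> C \<Longrightarrow> f c \<in> postcritical f C"
  unfolding postcritical_def by (auto intro!: bexI[of _ 1])

lemma postcritical_step: "p \<in> postcritical f C \<Longrightarrow> f p \<in> postcritical f C"
proof -
  assume "p \<in> postcritical f C"
  then obtain n c where "n \<ge> 1" "c \<in> C" "p = (f ^^ n) c" by (auto simp: postcritical_def)
  then show ?thesis unfolding postcritical_def by (auto intro!: bexI[of _ "Suc n"])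
qed

lemma weakly_of_type_typed:
  assumes "weakly_of_type f C b"
  shows "\<And>p. p \<in> postcritical f C \<Longrightarrow> app (Tree_Aut (b p)) = b p"
    and "typed f C (\<lambda>p. Tree_Aut (b p))"
proof -
  let ?P = "postcritical f C" and ?\<beta> = "\<lambda>p. Tree_Aut (b p)"
  have w: "\<forall>p\<in>?P. b p \<in> carrier treeW"
    "\<And>p c. p \<in> ?P \<Longrightarrow> c \<in> C - ?P \<Longrightarrow> p = f c \<Longrightarrow> b p \<sim>\<^sub>W sigma"
    "\<And>p c. p \<in> ?P \<Longrightarrow> c \<in> C \<inter> ?P \<Longrightarrow> p = f c \<Longrightarrow>
      b p \<sim>\<^sub>W tree_pair (b c) \<one>\<^bsub>treeW\<^esub> \<otimes>\<^bsub>treeW\<^esub> sigma"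
    "\<And>p q. p \<in> ?P \<Longrightarrow> q \<in> ?P - C \<Longrightarrow> p = f q \<and> (\<forall>r \<in> ?P - C. p = f r \<longrightarrow> r = q) \<Longrightarrow>
      b p \<sim>\<^sub>W tree_pair (b q) \<one>\<^bsub>treeW\<^esub>"
    "\<And>p q q'. p \<in> ?P \<Longrightarrow> q \<in> ?P - C \<Longrightarrow> q' \<in> ?P - C \<Longrightarrow> q \<noteq> q' \<and> p = f q \<and> p = f q' \<Longrightarrow>
      b p \<sim>\<^sub>W tree_pair (b q) (b q')"
    using assms unfolding weakly_of_type_def Let_def by blast+
  show b: "app (?\<beta> p) = b p" if "p \<in> ?P" for p
    using w(1) that by (simp add: Tree_Aut_inverse)
  show "typed f C ?\<beta>"
    unfolding typed_def Let_def
  proof (intro conjI ballI impI)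
    fix c assume c: "c \<in> C - ?P"
    then have "f c \<in> ?P" by (simp add: postcritical_image)
    with w(2)[OF this c] b[OF this] show "cj (?\<beta> (f c)) flip"
      by (simp flip: conj_W_app_iff sigma_app)
  next
    fix c assume c: "c \<in> C \<inter> ?P"
    then have fc: "f c \<in> ?P" by (simp add: postcritical_image)
    have "app (?\<beta> (f c)) \<sim>\<^sub>W app (pair (?\<beta> c) 0 + flip)"
      unfolding mult_treeW_app[symmetric] tree_pair_app[symmetric] sigma_app[symmetric]
        one_treeW_app[symmetric] using w(3)[OF fc c] b[OF fc] b[of c] c by simp
    then show "cj (?\<beta> (f c)) (pair (?\<beta> c) 0 + flip)" by (simp only: conj_W_app_iff)
  next
    fix q assume q: "q \<in> ?P - C" "\<forall>r\<in>?P - C. f r = f q \<longrightarrow> r = q"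
    then have fq: "f q \<in> ?P" by (simp add: postcritical_step)
    have "app (?\<beta> (f q)) \<sim>\<^sub>W app (pair (?\<beta> q) 0)"
      unfolding tree_pair_app[symmetric] one_treeW_app[symmetric]
      using w(4)[OF fq q(1)] q b[OF fq] b[of q] by simp
    then show "cj (?\<beta> (f q)) (pair (?\<beta> q) 0)" by (simp only: conj_W_app_iff)
  next
    fix q q' assume q: "q \<in> ?P - C" "q' \<in> ?P - C" "q \<noteq> q' \<and> f q = f q'"
    then have fq: "f q \<in> ?P" by (simp add: postcritical_step)
    have "app (?\<beta> (f q)) \<sim>\<^sub>W app (pair (?\<beta> q) (?\<beta> q'))"
      unfolding tree_pair_app[symmetric] using w(5)[OF fq q(1,2)] q b[OF fq] b[of q] b[of q'] by simp
    then show "cj (?\<beta> (f q)) (pair (?\<beta> q) (?\<beta> q'))" by (simp only: conj_W_app_iff)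
  qed
qed

section \<open>From the ordered product to the product relation\<close>

lemma foldr_app:
  assumes "\<And>p. p \<in> set ps \<Longrightarrow> app (\<beta> p) = b p"
  shows "foldr (\<lambda>p g. b p \<otimes>\<^bsub>treeW\<^esub> g) ps \<one>\<^bsub>treeW\<^esub> = app (sum_list (map \<beta> ps))"
  using assms
proof (induction ps)
  case (Cons p ps)
  then have "foldr (\<lambda>p g. b p \<otimes>\<^bsub>treeW\<^esub> g) (p # ps) \<one>\<^bsub>treeW\<^esub> =
      app (\<beta> p) \<otimes>\<^bsub>treeW\<^esub> app (sum_list (map \<beta> ps))" by simp
  then show ?case by (simp only: mult_treeW_app) simp
qed (simp only: one_treeW_app foldr.simps list.map sum_list.Nil id_apply)

lemma restrict_id_iff: "restrict (app g) (tree_level n) = restrict id (tree_level n) \<longleftrightarrow> g \<in> lev n"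
proof -
  have "restrict (app g) (tree_level n) = restrict (app 0) (tree_level n) \<longleftrightarrow> g \<in> lev n"
    unfolding restrict_app_eq_iff by (simp add: subgrp_minus_iff[OF subgrp_lev])
  then show ?thesis by (simp only: zero_tree_aut.rep_eq)
qed

lemma ordered_product_one_sum_list:
  assumes "ordered_product_one P ord b" and \<beta>: "\<And>p. p \<in> P \<Longrightarrow> app (\<beta> p) = b p"
  shows "\<exists>ps. distinct ps \<and> set ps = {p\<in>P. \<beta> p \<notin> lev n} \<and> sum_list (map \<beta> ps) \<in> lev n"
proof -
  obtain ps where ps: "distinct ps"
    "set ps = {p \<in> P. restrict (b p) (tree_level n) \<noteq> restrict id (tree_level n)}"
    "restrict (foldr (\<lambda>p g. b p \<otimes>\<^bsub>treeW\<^esub> g) ps \<one>\<^bsub>treeW\<^esub>) (tree_level n) = restrict id (tree_level n)"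
    using assms(1) unfolding ordered_product_one_def by blast
  have "set ps = {p\<in>P. \<beta> p \<notin> lev n}"
    unfolding ps(2) by (auto simp flip: \<beta> simp: restrict_id_iff)
  moreover have "foldr (\<lambda>p g. b p \<otimes>\<^bsub>treeW\<^esub> g) ps \<one>\<^bsub>treeW\<^esub> = app (sum_list (map \<beta> ps))"
    using ps(2) \<beta> by (intro foldr_app) auto
  ultimately show ?thesis using ps(1,3) by (auto simp: restrict_id_iff)
qed

text \<open>Members of F missing from the list act trivially at level n, so they can be appended
  without changing the relation.\<close>

lemma prod_rel_of_bij:
  assumes bij: "bij_betw \<pi> (idx R) P"
    and ps: "distinct ps" "set ps = {p\<in>P. \<beta> p \<notin> lev n}" "sum_list (map \<beta> ps) \<in> lev n"
  shows "prod_rel R n (\<lambda>i. \<beta> (\<pi> i))"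
  unfolding prod_rel_def
proof (intro allI impI)
  fix F assume F: "finite F \<and> F \<subseteq> idx R"
  let ?\<rho> = "inv_into (idx R) \<pi>"
  have \<rho>: "?\<rho> p \<in> idx R" "\<pi> (?\<rho> p) = p" if "p \<in> P" for p
    using that bij by (auto simp: bij_betw_def intro: inv_into_into f_inv_into_f)
  let ?xs = "map ?\<rho> ps"
  obtain ys where ys: "set ys = F - set ?xs" "distinct ys"
    using F finite_distinct_list[of "F - set ?xs"] by auto
  have "inj_on ?\<rho> (set ps)" using ps(2) \<rho>(2) by (intro inj_onI) (metis (mono_tags, lifting) mem_Collect_eq)
  then have "distinct (?xs @ ys)" using ps(1) ys by (auto simp: distinct_map)
  moreover have "F \<subseteq> set (?xs @ ys)" using ys by auto
  moreover have "set (?xs @ ys) \<subseteq> idx R" using ys F ps(2) \<rho>(1) by auto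
  moreover have "sum_list (map (\<lambda>i. \<beta> (\<pi> i)) (?xs @ ys)) \<in> lev n"
  proof -
    have "map (\<lambda>i. \<beta> (\<pi> i)) ?xs = map \<beta> ps" using ps(2) \<rho>(2) by auto
    moreover have "\<beta> (\<pi> i) \<in> lev n" if "i \<in> set ys" for i
    proof (rule ccontr)
      assume "\<beta> (\<pi> i) \<notin> lev n"
      moreover have "i \<in> idx R" using that ys F by auto
      ultimately have "\<pi> i \<in> set ps" "?\<rho> (\<pi> i) = i"
        using ps(2) bij by (auto simp: bij_betw_def)
      then have "i \<in> set ?xs" by (metis image_eqI list.set_map)
      then show False using that ys by auto
    qed
    then have "sum_list (map (\<lambda>i. \<beta> (\<pi> i)) ys) \<in> lev n" by (intro subgrp_sum_list[OF subgrp_lev]) auto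
    ultimately show ?thesis using ps(3) by (simp only: map_append sum_list_append subgrp_add[OF subgrp_lev])
  qed
  ultimately show "\<exists>xs. distinct xs \<and> F \<subseteq> set xs \<and> set xs \<subseteq> idx R \<and> sum_list (map (\<lambda>i. \<beta> (\<pi> i)) xs) \<in> lev n"
    by blast
qed

section \<open>Coincidences between the two critical orbits\<close>

lemma postcritical_pair:
  "postcritical f {x, y} = range (\<lambda>i. (f ^^ Suc i) x) \<union> range (\<lambda>i. (f ^^ Suc i) y)"
proof -
  have "{1..} = range Suc" by (metis One_nat_def atLeast_Suc_greaterThan greaterThan_0)
  then show ?thesis unfolding postcritical_def by auto
qed

lemma inj_orbit_of_infinite:
  fixes f :: "'x \<Rightarrow> 'x"
  assumes "infinite (range (\<lambda>i. (f ^^ Suc i) x))"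
  shows "inj (\<lambda>i. (f ^^ i) x)"
proof (rule ccontr)
  assume "\<not> ?thesis"
  then obtain i j where "i < j" and ij: "(f ^^ i) x = (f ^^ j) x"
    unfolding inj_def by (metis linorder_neqE_nat)
  have "(f ^^ k) x \<in> (\<lambda>i. (f ^^ i) x) ` {..<j}" for k
  proof (induction k)
    case 0
    show ?case using \<open>i < j\<close> by (intro image_eqI[of _ _ 0]) auto
  next
    case (Suc k)
    then obtain l where l: "l < j" "(f ^^ k) x = (f ^^ l) x" by auto
    have eq: "(f ^^ Suc k) x = (f ^^ Suc l) x" by (simp only: funpow.simps comp_apply l(2))
    show ?case
    proof (cases "Suc l = j")
      case True
      then show ?thesis using eq ij \<open>i < j\<close> by (intro image_eqI[of _ _ i]) simp_all
    next
      case False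
      then show ?thesis using eq l(1) by (intro image_eqI[of _ _ "Suc l"]) simp_all
    qed
  qed
  then have "range (\<lambda>i. (f ^^ Suc i) x) \<subseteq> (\<lambda>i. (f ^^ i) x) ` {..<j}" by blast
  then show False using assms finite_subset by blast
qed

text \<open>x plays the critical point with infinite orbit. \<open>X 0\<close> and
  \<open>Y 0\<close> are the critical points themselves, so the critical values have index
  1.\<close>

locale two_orbits =
  fixes f :: "'x \<Rightarrow> 'x" and x y :: 'x
  assumes inj_x: "inj (\<lambda>i. (f ^^ i) x)"
begin

abbreviation X :: "nat \<Rightarrow> 'x" where "X i \<equiv> (f ^^ i) x"
abbreviation Y :: "nat \<Rightarrow> 'x" where "Y i \<equiv> (f ^^ i) y"
abbreviation P :: "'x set" where "P \<equiv> postcritical f {x, y}"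

lemma X_eq_iff: "X i = X j \<longleftrightarrow> i = j"
  using inj_x by (auto simp: inj_def)

lemma P_iff: "p \<in> P \<longleftrightarrow> (\<exists>i. p = X (Suc i)) \<or> (\<exists>i. p = Y (Suc i))"
  by (auto simp: postcritical_pair)

lemma X_in_P: "X (Suc i) \<in> P" and Y_in_P: "Y (Suc i) \<in> P"
  by (auto simp only: P_iff)

lemma typedD:
  assumes "typed f {x, y} \<beta>"
  shows "x \<notin> P \<Longrightarrow> cj (\<beta> (X (Suc 0))) flip"
    and "y \<notin> P \<Longrightarrow> cj (\<beta> (Y (Suc 0))) flip"
    and "y \<in> P \<Longrightarrow> cj (\<beta> (Y (Suc 0))) (pair (\<beta> y) 0 + flip)"
    and "\<And>q. q \<in> P \<Longrightarrow> q \<noteq> x \<Longrightarrow> q \<noteq> y \<Longrightarrow>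
      (\<And>i. f (X (Suc i)) = f q \<Longrightarrow> X (Suc i) = q) \<Longrightarrow> (\<And>j. f (Y (Suc j)) = f q \<Longrightarrow> Y (Suc j) = q) \<Longrightarrow>
      cj (\<beta> (f q)) (pair (\<beta> q) 0)"
    and "\<And>q q'. q \<in> P \<Longrightarrow> q \<noteq> x \<Longrightarrow> q \<noteq> y \<Longrightarrow> q' \<in> P \<Longrightarrow> q' \<noteq> x \<Longrightarrow> q' \<noteq> y \<Longrightarrow>
      q \<noteq> q' \<Longrightarrow> f q = f q' \<Longrightarrow> cj (\<beta> (f q)) (pair (\<beta> q) (\<beta> q'))"
proof -
  have t: "\<forall>c\<in>{x, y} - P. cj (\<beta> (f c)) flip"
     "\<forall>c\<in>{x, y} \<inter> P. cj (\<beta> (f c)) (pair (\<beta> c) 0 + flip)"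
     "\<forall>q\<in>P - {x, y}. (\<forall>r\<in>P - {x, y}. f r = f q \<longrightarrow> r = q) \<longrightarrow> cj (\<beta> (f q)) (pair (\<beta> q) 0)"
     "\<forall>q\<in>P - {x, y}. \<forall>q'\<in>P - {x, y}. q \<noteq> q' \<and> f q = f q' \<longrightarrow> cj (\<beta> (f q)) (pair (\<beta> q) (\<beta> q'))"
    using assms unfolding typed_def Let_def by - (elim conjE, assumption)+
  show "x \<notin> P \<Longrightarrow> cj (\<beta> (X (Suc 0))) flip" "y \<notin> P \<Longrightarrow> cj (\<beta> (Y (Suc 0))) flip"
    "y \<in> P \<Longrightarrow> cj (\<beta> (Y (Suc 0))) (pair (\<beta> y) 0 + flip)"
    using t(1,2) by auto
  show "cj (\<beta> (f q)) (pair (\<beta> q) 0)"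
    if "q \<in> P" "q \<noteq> x" "q \<noteq> y" and X: "\<And>i. f (X (Suc i)) = f q \<Longrightarrow> X (Suc i) = q"
      and Y: "\<And>j. f (Y (Suc j)) = f q \<Longrightarrow> Y (Suc j) = q" for q
  proof -
    have "r = q" if "r \<in> P" "f r = f q" for r
      using that X Y unfolding P_iff by blast
    then show ?thesis using t(3) that(1-3) by blast
  qed
  show "cj (\<beta> (f q)) (pair (\<beta> q) (\<beta> q'))"
    if "q \<in> P" "q \<noteq> x" "q \<noteq> y" "q' \<in> P" "q' \<noteq> x" "q' \<noteq> y" "q \<noteq> q'" "f q = f q'" for q q'
    using t(4) that by blast
qed

lemma gen_UNIV_mono:
  assumes "gen (S \<union> lev n) = UNIV" "S \<subseteq> \<beta> ` P"
  shows "gen (\<beta> ` P \<union> lev n) = UNIV"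
  using gen_mono[of "S \<union> lev n" "\<beta> ` P \<union> lev n"] assms by blast

text \<open>The elements along the orbit of x already form a sequence as in
  \<open>gen_free_orbit\<close>.\<close>

lemma gen_disjoint_orbits:
  assumes "typed f {x, y} \<beta>" and disj: "\<And>i j. X i \<noteq> Y j"
  shows "gen (\<beta> ` P \<union> lev n) = UNIV"
proof -
  have "cj (\<beta> (X (Suc 0))) flip"
    using disj[of 0] X_eq_iff[of 0] by (intro typedD(1)[OF assms(1)]) (auto simp: P_iff simp del: funpow.simps(2))
  moreover have "cj (\<beta> (X (Suc (Suc i)))) (pair (\<beta> (X (Suc i))) 0)" for i
  proof -
    have "cj (\<beta> (f (X (Suc i)))) (pair (\<beta> (X (Suc i))) 0)"
    proof (rule typedD(4)[OF assms(1) X_in_P])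
      show "X (Suc i) \<noteq> x" using X_eq_iff[of "Suc i" 0] by simp
      show "X (Suc i) \<noteq> y" using disj[of "Suc i" 0] by simp
      show "X (Suc j) = X (Suc i)" if "f (X (Suc j)) = f (X (Suc i))" for j
        using that X_eq_iff[of "Suc (Suc j)" "Suc (Suc i)"] by simp
      show "Y (Suc j) = X (Suc i)" if "f (Y (Suc j)) = f (X (Suc i))" for j
        using that disj[of "Suc (Suc i)" "Suc (Suc j)"] by simp
    qed
    then show ?thesis by simp
  qed
  ultimately have "gen (range (\<lambda>i. \<beta> (X (Suc i))) \<union> lev n) = UNIV" by (rule gen_free_orbit)
  then show ?thesis by (rule gen_UNIV_mono) (use X_in_P in blast)
qed

lemma gen_orbit_hits_critical:
  assumes "typed f {x, y} \<beta>" and y: "y = X (Suc M)"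
  shows "gen (\<beta> ` P \<union> lev n) = UNIV"
proof -
  have Y: "Y j = X (j + Suc M)" for j by (simp only: y funpow_add comp_apply)
  have "cj (\<beta> (X (Suc 0))) flip"
    using X_eq_iff[of 0] by (intro typedD(1)[OF assms(1)]) (auto simp: P_iff Y simp del: funpow.simps(2))
  moreover have "cj (\<beta> (X (Suc (Suc i)))) (pair (\<beta> (X (Suc i))) 0)" if "i \<noteq> M" for i
  proof -
    have "cj (\<beta> (f (X (Suc i)))) (pair (\<beta> (X (Suc i))) 0)"
    proof (rule typedD(4)[OF assms(1) X_in_P])
      show "X (Suc i) \<noteq> x" using X_eq_iff[of "Suc i" 0] by simp
      show "X (Suc i) \<noteq> y" using that X_eq_iff[of "Suc i" "Suc M"] y by simp
      show *: "X (Suc j) = X (Suc i)" if "f (X (Suc j)) = f (X (Suc i))" for j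
        using that X_eq_iff[of "Suc (Suc j)" "Suc (Suc i)"] by simp
      show "Y (Suc j) = X (Suc i)" if "f (Y (Suc j)) = f (X (Suc i))" for j
        using that *[of "Suc j + M"] by (simp add: Y)
    qed
    then show ?thesis by simp
  qed
  moreover have "cj (\<beta> (X (Suc (Suc M)))) (pair (\<beta> (X (Suc M))) 0 + flip)"
    using typedD(3)[OF assms(1)] X_in_P[of M] unfolding y by simp
  ultimately have "gen (range (\<lambda>i. \<beta> (X (Suc i))) \<union> lev n) = UNIV" by (rule gen_orbit_through_critical)
  then show ?thesis by (rule gen_UNIV_mono) (use X_in_P in blast)
qed

end

locale merging_orbits = two_orbits f x y for f :: "'x \<Rightarrow> 'x" and x y +
  fixes m n :: nat
  assumes merge: "(f ^^ Suc m) x = (f ^^ Suc n) y" and not_merged: "(f ^^ m) x \<noteq> (f ^^ n) y"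
begin

text \<open>Applying f further moves any coincidence into the common tail, where injectivity along
  the orbit of x forces the index equation; a coincidence before the merge would propagate to
  \<open>X m\<close> and \<open>Y n\<close>.\<close>

lemma X_eq_Y_iff: "X i = Y j \<longleftrightarrow> i + n = j + m \<and> m < i"
proof
  assume *: "X i = Y j"
  have "X (Suc n + i) = Y (Suc n + j)" using * by (simp only: funpow_add comp_apply)
  also have "\<dots> = Y (j + Suc n)" by (simp only: add.commute)
  also have "\<dots> = X (j + Suc m)" using merge by (simp only: funpow_add comp_apply)
  finally have ij: "i + n = j + m" using X_eq_iff[of "Suc n + i" "j + Suc m"] by simp
  moreover have "m < i"
  proof (rule ccontr)
    assume "\<not> m < i"
    then have "m = (m - i) + i" "n = (m - i) + j" using ij by auto
    then have "X m = Y n" using * by (metis comp_apply funpow_add)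
    then show False using not_merged by simp
  qed
  ultimately show "i + n = j + m \<and> m < i" by simp
next
  assume "i + n = j + m \<and> m < i"
  then obtain k where "i = k + Suc m" "j = k + Suc n"
    by (metis (no_types, lifting) add.commute add_Suc_right add_left_cancel add.assoc less_imp_Suc_add)
  then show "X i = Y j" using merge by (simp only: funpow_add comp_apply)
qed

lemma Y_eq_iff: "Y i = Y j \<longleftrightarrow> i = j"
proof
  assume "Y i = Y j"
  then have "Y (Suc n + i) = Y (Suc n + j)" by (simp only: funpow_add comp_apply)
  then have "X (Suc m + i) = Y (Suc n + j)" using X_eq_Y_iff[of "Suc m + i" "Suc n + i"] by simp
  then show "i = j" using X_eq_Y_iff[of "Suc m + i" "Suc n + j"] by simp
qed simp

text \<open>Here f y = f (X m) with \<open>X m\<close> postcritical but not critical: the condition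
  at y requires an element that moves level one, the condition at \<open>X m\<close> one that fixes
  it.\<close>

lemma not_typed:
  assumes "n = 0" "m \<noteq> 0"
  shows "\<not> typed f {x, y} \<beta>"
proof
  assume t: "typed f {x, y} \<beta>"
  obtain k where k: "m = Suc k" using assms by (cases m) auto
  have "cj (\<beta> (Y (Suc 0))) flip \<or> cj (\<beta> (Y (Suc 0))) (pair (\<beta> y) 0 + flip)"
    using typedD(2,3)[OF t] by blast
  then have 1: "\<exists>a b. cj (\<beta> (Y (Suc 0))) (pair a b + flip)"
    by (metis add_0_left pair_zero)
  have "cj (\<beta> (f (X (Suc k)))) (pair (\<beta> (X (Suc k))) 0)"
  proof (rule typedD(4)[OF t X_in_P])
    show "X (Suc k) \<noteq> x" using X_eq_iff[of "Suc k" 0] by simp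
    show "X (Suc k) \<noteq> y" using not_merged k assms by simp
    show "X (Suc j) = X (Suc k)" if "f (X (Suc j)) = f (X (Suc k))" for j
      using that X_eq_iff[of "Suc (Suc j)" "Suc (Suc k)"] by simp
    show "Y (Suc j) = X (Suc k)" if "f (Y (Suc j)) = f (X (Suc k))" for j
      using that X_eq_Y_iff[of "Suc (Suc k)" "Suc (Suc j)"] k assms by simp
  qed
  then have "cj (\<beta> (Y (Suc 0))) (pair (\<beta> (X (Suc k))) 0)" using merge k assms by simp
  then show False using 1 cj_pair_flip_not_cj_pair by blast
qed

text \<open>Indices now count from the critical values, which lowers m and n by one. Neither
  critical point is postcritical, and two postcritical points with the same image occur only at the
  merge.\<close>

lemma merging_of_typed:
  assumes t: "typed f {x, y} \<beta>" and m: "m = Suc M" and n: "n = Suc N"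
  shows "merging M N (\<lambda>i. \<beta> (X (Suc i))) (\<lambda>j. \<beta> (Y (Suc j)))"
  unfolding merging_def
proof (intro conjI allI impI)
  have neq: "X (Suc i) \<noteq> x" "Y (Suc i) \<noteq> y" "Y j \<noteq> x" "X j \<noteq> y" for i j
    using X_eq_iff[of "Suc i" 0] Y_eq_iff[of "Suc i" 0] X_eq_Y_iff[of 0 j] X_eq_Y_iff[of j 0] n
    by auto
  have inj: "f (X i) = f (X j) \<Longrightarrow> X i = X j" "f (Y i) = f (Y j) \<Longrightarrow> Y i = Y j" for i j
    using X_eq_iff[of "Suc i" "Suc j"] Y_eq_iff[of "Suc i" "Suc j"] by auto
  have xP: "x \<notin> P" and yP: "y \<notin> P" unfolding P_iff using neq by metis+
  show "cj (\<beta> (X (Suc 0))) flip" "cj (\<beta> (Y (Suc 0))) flip"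
    using typedD(1,2)[OF t] xP yP by blast+
  show "cj (\<beta> (X (Suc (Suc i)))) (pair (\<beta> (X (Suc i))) 0)" if "i \<noteq> M" for i
  proof -
    have "cj (\<beta> (f (X (Suc i)))) (pair (\<beta> (X (Suc i))) 0)"
    proof (rule typedD(4)[OF t X_in_P])
      show "X (Suc i) \<noteq> x" "X (Suc i) \<noteq> y" using neq by blast+
      show "X (Suc j) = X (Suc i)" if "f (X (Suc j)) = f (X (Suc i))" for j using that inj by blast
      show "Y (Suc j) = X (Suc i)" if "f (Y (Suc j)) = f (X (Suc i))" for j
        using that X_eq_Y_iff[of "Suc (Suc i)" "Suc (Suc j)"] X_eq_Y_iff[of "Suc i" "Suc j"] \<open>i \<noteq> M\<close> m by auto
    qed
    then show ?thesis by simp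
  qed
  show "cj (\<beta> (Y (Suc (Suc i)))) (pair (\<beta> (Y (Suc i))) 0)" if "i < N" for i
  proof -
    have "cj (\<beta> (f (Y (Suc i)))) (pair (\<beta> (Y (Suc i))) 0)"
    proof (rule typedD(4)[OF t Y_in_P])
      show "Y (Suc i) \<noteq> x" "Y (Suc i) \<noteq> y" using neq by blast+
      show "Y (Suc j) = Y (Suc i)" if "f (Y (Suc j)) = f (Y (Suc i))" for j using that inj by blast
      show "X (Suc j) = Y (Suc i)" if "f (X (Suc j)) = f (Y (Suc i))" for j
        using that X_eq_Y_iff[of "Suc (Suc j)" "Suc (Suc i)"] \<open>i < N\<close> m n by auto
    qed
    then show ?thesis by simp
  qed
  have "cj (\<beta> (f (X (Suc M)))) (pair (\<beta> (X (Suc M))) (\<beta> (Y (Suc N))))"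
  proof (rule typedD(5)[OF t X_in_P _ _ Y_in_P])
    show "X (Suc M) \<noteq> x" "X (Suc M) \<noteq> y" "Y (Suc N) \<noteq> x" "Y (Suc N) \<noteq> y" using neq by blast+
    show "X (Suc M) \<noteq> Y (Suc N)" "f (X (Suc M)) = f (Y (Suc N))" using merge not_merged m n by auto
  qed
  then show "cj (\<beta> (X (Suc (Suc M)))) (pair (\<beta> (X (Suc M))) (\<beta> (Y (Suc N))))" by simp
qed

text \<open>Both orbits need equally many steps to merge, so beyond index R the second one agrees
  with the first index by index.\<close>

lemma bij_betw_idx:
  assumes "m = Suc R" "n = Suc R"
  shows "bij_betw (case_sum (\<lambda>i. X (Suc i)) (\<lambda>j. Y (Suc j))) (idx R) P"
  unfolding bij_betw_def
proof
  let ?\<pi> = "case_sum (\<lambda>i. X (Suc i)) (\<lambda>j. Y (Suc j))"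
  show "inj_on ?\<pi> (idx R)"
  proof (rule inj_onI)
    fix p q assume pq: "p \<in> idx R" "q \<in> idx R" "?\<pi> p = ?\<pi> q"
    have "X (Suc i) \<noteq> Y (Suc j)" if "j \<le> R" for i j
      using that X_eq_Y_iff[of "Suc i" "Suc j"] assms by auto
    then show "p = q" using pq X_eq_iff Y_eq_iff
      by (cases p; cases q) (auto simp del: funpow.simps(2) simp: eq_commute[of "Y _" "X _"])
  qed
  show "?\<pi> ` idx R = P"
  proof (intro equalityI subsetI)
    fix p assume "p \<in> ?\<pi> ` idx R"
    then show "p \<in> P" using X_in_P Y_in_P by (auto simp: idx_def simp del: funpow.simps(2))
  next
    fix p assume "p \<in> P"
    then consider i where "p = X (Suc i)" | j where "p = Y (Suc j)" unfolding P_iff by blast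
    then show "p \<in> ?\<pi> ` idx R"
    proof cases
      case (1 i)
      then show ?thesis by (intro image_eqI[of _ _ "Inl i"]) auto
    next
      case (2 j)
      show ?thesis
      proof (cases "j \<le> R")
        case True
        then show ?thesis using 2 by (intro image_eqI[of _ _ "Inr j"]) auto
      next
        case False
        then have "X (Suc j) = Y (Suc j)" using X_eq_Y_iff[of "Suc j" "Suc j"] assms by simp
        then show ?thesis using 2 by (intro image_eqI[of _ _ "Inl j"]) auto
      qed
    qed
  qed
qed

lemma conjugate_of_typed:
  assumes "f x \<noteq> f y"
    and t: "typed f {x, y} \<beta>" "typed f {x, y} \<beta>'"
    and prod: "\<And>\<gamma>. \<gamma> = \<beta> \<or> \<gamma> = \<beta>' \<Longrightarrow>
      \<exists>ps. distinct ps \<and> set ps = {p\<in>P. \<gamma> p \<notin> lev k} \<and> sum_list (map \<gamma> ps) \<in> lev k"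
  shows "\<exists>v. gen (\<beta> ` P \<union> lev k) = conj_by v ` gen (\<beta>' ` P \<union> lev k)"
proof -
  interpret sym: merging_orbits f y x n m
    using Y_eq_iff merge not_merged by unfold_locales (auto simp: inj_def)
  \<comment> \<open>With m = n = 0 the critical values would coincide; if only one of them is 0, no
    system has the given type.\<close>
  have "\<not> (m = 0 \<and> n = 0)" using merge assms(1) by (auto intro!: Nat.gr0I)
  moreover have "\<not> (n = 0 \<and> m \<noteq> 0)" using not_typed t(1) by blast
  moreover have "\<not> (m = 0 \<and> n \<noteq> 0)" using sym.not_typed t(1) by (metis insert_commute)
  ultimately obtain M N where mn: "m = Suc M" "n = Suc N" by (metis not0_implies_Suc)
  note mg = merging_of_typed[OF _ mn]
  show ?thesis
  proof (cases "M = N")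
    case False
    have "gen (\<gamma> ` P \<union> lev k) = UNIV" if "typed f {x, y} \<gamma>" for \<gamma>
      using gen_merging[OF mg[OF that] False, of k]
      by (rule gen_UNIV_mono) (use X_in_P Y_in_P in blast)
    then have "gen (\<beta> ` P \<union> lev k) = conj_by 0 ` gen (\<beta>' ` P \<union> lev k)" using t by simp
    then show ?thesis by blast
  next
    case True
    let ?\<pi> = "case_sum (\<lambda>i. X (Suc i)) (\<lambda>j. Y (Suc j))"
    have bij: "bij_betw ?\<pi> (idx N) P" using bij_betw_idx mn True by simp
    have sys: "system N (\<lambda>i. \<gamma> (?\<pi> i))" if "typed f {x, y} \<gamma>" for \<gamma>
      using mg[OF that] True by (simp add: system_def)
    have rel: "prod_rel N k (\<lambda>i. \<gamma> (?\<pi> i))" if "\<gamma> = \<beta> \<or> \<gamma> = \<beta>'" for \<gamma>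
      using prod[OF that] prod_rel_of_bij[OF bij] by blast
    have im: "(\<lambda>i. \<gamma> (?\<pi> i)) ` idx N = \<gamma> ` P" for \<gamma> :: "'x \<Rightarrow> tree_aut"
      using bij by (metis bij_betw_imp_surj_on image_image)
    obtain v where "equivalent N k (\<lambda>i. conj_by v (\<beta>' (?\<pi> i))) (\<lambda>i. \<beta> (?\<pi> i))"
      using systems_equivalent[OF sys[OF t(2)] sys[OF t(1)] rel[of \<beta>'] rel[of \<beta>]] by blast
    then have "gen (conj_by v ` (\<lambda>i. \<beta>' (?\<pi> i)) ` idx N \<union> lev k) = gen ((\<lambda>i. \<beta> (?\<pi> i)) ` idx N \<union> lev k)"
      unfolding equivalent_def image_image by simp
    then have "gen (\<beta> ` P \<union> lev k) = conj_by v ` gen (\<beta>' ` P \<union> lev k)"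
      unfolding im gen_conj_by_lev by simp
    then show ?thesis by blast
  qed
qed

end

text \<open>Split according to the first i at which the orbit of x meets that of y: no meeting, a
  meeting at one of the critical points, or a proper merge.\<close>

lemma (in two_orbits) conjugate_of_typed:
  assumes "x \<noteq> y" "f x \<noteq> f y"
    and t: "typed f {x, y} \<beta>" "typed f {x, y} \<beta>'"
    and prod: "\<And>\<gamma>. \<gamma> = \<beta> \<or> \<gamma> = \<beta>' \<Longrightarrow>
      \<exists>ps. distinct ps \<and> set ps = {p\<in>P. \<gamma> p \<notin> lev k} \<and> sum_list (map \<gamma> ps) \<in> lev k"
  shows "\<exists>v. gen (\<beta> ` P \<union> lev k) = conj_by v ` gen (\<beta>' ` P \<union> lev k)"
proof -
  have full: ?thesis if "\<And>\<gamma>. typed f {x, y} \<gamma> \<Longrightarrow> gen (\<gamma> ` P \<union> lev k) = UNIV"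
  proof -
    have "gen (\<beta> ` P \<union> lev k) = conj_by 0 ` gen (\<beta>' ` P \<union> lev k)" using t that by simp
    then show ?thesis by blast
  qed
  show ?thesis
  proof (cases "\<exists>i j. X i = Y j")
    case False
    then show ?thesis using gen_disjoint_orbits by (intro full) blast
  next
    case True
    define i where "i = (LEAST i. \<exists>j. X i = Y j)"
    have "\<exists>j. X i = Y j" unfolding i_def using True by (rule LeastI_ex)
    then obtain j where ij: "X i = Y j" by blast
    have least: "X l \<noteq> Y l'" if "l < i" for l l'
      using not_less_Least[of l "\<lambda>i. \<exists>j. X i = Y j"] that unfolding i_def by blast
    consider "i = 0" | "i \<noteq> 0" "j = 0" | m n where "i = Suc m" "j = Suc n"
      by (metis not0_implies_Suc)
    then show ?thesis
    proof cases
      case 1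
      then have x: "x = Y j" using ij by simp
      then obtain M where M: "j = Suc M" using assms(1) by (cases j) auto
      \<comment> \<open>x lies on the orbit of y, so that orbit is infinite too and the roles of x
        and y can be exchanged.\<close>
      have "inj Y"
      proof (rule injI)
        fix k l assume "Y k = Y l"
        then have "Y (j + k) = Y (j + l)" by (simp only: funpow_add comp_apply)
        then have "Y (k + j) = Y (l + j)" by (simp only: add.commute)
        then have "X k = X l" unfolding x by (simp only: funpow_add comp_apply)
        then show "k = l" by (simp only: X_eq_iff)
      qed
      then interpret sym: two_orbits f y x by unfold_locales
      have "postcritical f {y, x} = P" "{y, x} = {x, y}" by (simp_all add: insert_commute)
      then show ?thesis using sym.gen_orbit_hits_critical[OF _ x[unfolded M]] by (intro full) metis
    next
      case 2
      then obtain M where "i = Suc M" by (cases i) auto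
      then have "y = X (Suc M)" using 2 ij by simp
      then show ?thesis using gen_orbit_hits_critical by (intro full) blast
    next
      case (3 m n)
      interpret merging_orbits f x y m n
        \<comment> \<open>Minimality of i is what keeps the predecessors \<open>X m\<close> and
          \<open>Y n\<close> apart.\<close>
        using ij least[of m n] 3 by unfold_locales auto
      show ?thesis using conjugate_of_typed[OF assms(2) t prod] .
    qed
  qed
qed

lemma group_strongly_of_typeE:
  assumes "group_strongly_of_type f C G"
  obtains \<beta> where "typed f C \<beta>"
    "\<forall>n. \<exists>ps. distinct ps \<and> set ps = {p\<in>postcritical f C. \<beta> p \<notin> lev n} \<and> sum_list (map \<beta> ps) \<in> lev n"
    "G = app ` {g. \<forall>n. g \<in> gen (\<beta> ` postcritical f C \<union> lev n)}"
proof -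
  obtain b ord where b: "weakly_of_type f C b" "ordered_product_one (postcritical f C) ord b"
    "G = treeW_topology closure_of (generate treeW (b ` postcritical f C))"
    using assms unfolding group_strongly_of_type_def strongly_of_type_def by blast
  let ?\<beta> = "\<lambda>p. Tree_Aut (b p)"
  note w = weakly_of_type_typed[OF b(1)]
  have "b ` postcritical f C = app ` ?\<beta> ` postcritical f C" using w(1) by (auto simp: image_image)
  then have "G = app ` {g. \<forall>n. g \<in> gen (?\<beta> ` postcritical f C \<union> lev n)}"
    using b(3) by (simp only: generate_app closure_of_app gen_lev_iff)
  then show ?thesis 
    by (intro that[OF w(2)] allI ordered_product_one_sum_list[OF b(2) w(1)])
qed

theorem theorem4p1p6:
  fixes f :: "'x \<Rightarrow> 'x" and C :: "'x set" and p\<^sub>0 q\<^sub>0 :: 'x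
    and G H :: "(vertex \<Rightarrow> vertex) set"
  assumes "C = {p\<^sub>0, q\<^sub>0}" and "p\<^sub>0 \<noteq> q\<^sub>0" and "f p\<^sub>0 \<noteq> f q\<^sub>0"
    and "infinite (postcritical f C)"
    and "group_strongly_of_type f C G" and "group_strongly_of_type f C H"
  shows "subgroups_conj_W G H"
proof -
  let ?P = "postcritical f C"
  obtain \<beta> where \<beta>: "typed f C \<beta>"
    "\<forall>n. \<exists>ps. distinct ps \<and> set ps = {p\<in>?P. \<beta> p \<notin> lev n} \<and> sum_list (map \<beta> ps) \<in> lev n"
    "G = app ` {g. \<forall>n. g \<in> gen (\<beta> ` ?P \<union> lev n)}"
    using assms(5) by (rule group_strongly_of_typeE)
  obtain \<beta>' where \<beta>': "typed f C \<beta>'"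
    "\<forall>n. \<exists>ps. distinct ps \<and> set ps = {p\<in>?P. \<beta>' p \<notin> lev n} \<and> sum_list (map \<beta>' ps) \<in> lev n"
    "H = app ` {g. \<forall>n. g \<in> gen (\<beta>' ` ?P \<union> lev n)}"
    using assms(6) by (rule group_strongly_of_typeE)
  \<comment> \<open>The postcritical set is the union of two forward orbits, so one of them is
    infinite; its critical point is taken as x.\<close>
  have "\<exists>x y. C = {x, y} \<and> x \<noteq> y \<and> f x \<noteq> f y \<and> infinite (range (\<lambda>i. (f ^^ Suc i) x))"
  proof (cases "finite (range (\<lambda>i. (f ^^ Suc i) p\<^sub>0))")
    case True
    then have "infinite (range (\<lambda>i. (f ^^ Suc i) q\<^sub>0))"
      using assms(1,4) by (simp only: postcritical_pair finite_Un) blast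
    then show ?thesis using assms(1-3) by (metis insert_commute)
  next
    case False
    then show ?thesis using assms(1-3) by blast
  qed
  then obtain x y where xy: "C = {x, y}" "x \<noteq> y" "f x \<noteq> f y"
    "infinite (range (\<lambda>i. (f ^^ Suc i) x))" by blast
  interpret two_orbits f x y by unfold_locales (rule inj_orbit_of_infinite[OF xy(4)])
  have "\<exists>v. gen (\<beta> ` ?P \<union> lev n) = conj_by v ` gen (\<beta>' ` ?P \<union> lev n)" for n
    using conjugate_of_typed[OF xy(2,3), of \<beta> \<beta>' n] \<beta>(1,2) \<beta>'(1,2) unfolding xy(1) by blast
  then have "\<exists>v. {g. \<forall>n. g \<in> gen (\<beta> ` ?P \<union> lev n)} = conj_by v ` {g. \<forall>n. g \<in> gen (\<beta>' ` ?P \<union> lev n)}"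
    by (rule conjugate_closures)
  then show ?thesis unfolding \<beta>(3) \<beta>'(3) using subgroups_conj_W_app by blast
qed

end
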